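(* Consider the perturbed Super-Kagome lattice with fixed vertex weight $\mu>0$ and periodic edge weights $\gamma_1,\dots,\gamma_9>0$ satisfying the constant vertex weight condition $$\gamma_2+\gamma_3+\gamma_7=\gamma_5+\gamma_6+\gamma_7=\gamma_1+\gamma_2+\gamma_8=\gamma_4+\gamma_5+\gamma_8=\gamma_1+\gamma_3+\gamma_9=\gamma_4+\gamma_6+\gamma_9=\mu,$$ and with Laplacian $(\Delta_\gamma f)(v)=f(v)-\frac1\mu\sum_{w\sim v}\gamma_{vw}f(w)$ on $\ell^2(V)$. Let $S$ be the set of such $(\gamma_1,\dots,\gamma_9)$ for which $\Delta_\gamma$ has exactly one flat band. Then $S$ consists of six connected components, which have no mutual intersections and have no intersection with the two-flat-band parameter set $\{\gamma_1=\dots=\gamma_6=\alpha,\ \gamma_7=\gamma_8=\gamma_9=\beta : \alpha,\beta>0,\ 2\alpha+\beta=\mu\}$. The set $S$ is invariant under those permutations of the $\gamma_i$ which correspond to rotations of the lattice by $\frac{2\pi}{3}$ and $\frac{4\pi}{3}$. Modulo these permutations, there are two connected components, which are described as follows (with $\gamma_4=\gamma_1$, $\gamma_5=\gamma_2$, $\gamma_6=\gamma_3$ throughout): (1) A one-dimensional submanifold, isomorphic to an interval, given by $$\gamma_1=\gamma_3=\frac{\mu-\beta'}{2},\quad \gamma_2=\alpha'\in\left(\frac{\mu}{2},\mu\right),\quad \gamma_7=\gamma_8=\frac{\mu+\beta'}{2}-\alpha',\quad \gamma_9=\beta':=\mu-3\alpha'+\sqrt{17\alpha'^2-8\alpha'\mu}.$$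 (2) The union of two one-dimensional submanifolds, each isomorphic to an interval, which intersect in a single point, given respectively by $$\text{(a)}\quad \gamma_1=\gamma_3=\frac{\mu-\beta'}{2},\quad \gamma_2=\alpha'\in\left(0,\frac{\mu}{2}\right),\quad \gamma_7=\gamma_8=\frac{\mu+\beta'}{2}-\alpha',\quad \gamma_9=\beta':=\mu+3\alpha'-\sqrt{9\alpha'^2+8\alpha'\mu},$$ and $$\text{(b)}\quad \gamma_1=\alpha''\in(0,\mu),\quad \gamma_2=\frac{\alpha''\beta''}{\alpha''+\beta''},\quad \gamma_3=\beta'':=\frac{\mu-3\alpha''+\sqrt{\mu^2-2\alpha''\mu+5\alpha''^2}}{2},$$ $$\gamma_7=\mu-\frac{2\alpha''\beta''+\beta''^2}{\alpha''+\beta''},\quad \gamma_8=\mu-\frac{\alpha''^2+2\alpha''\beta''}{\alpha''+\beta''},\quad \gamma_9=\mu-\alpha''-\beta''.$$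
   Context: The Super-Kagome lattice is the Archimedean tiling $(3.12^2)$, in which every vertex is surrounded by one triangle and two dodecagons. As a graph with periodic edge weights it is described as follows. The vertex set is $V=\{v_j+\beta : j\in\{1,\dots,6\},\ \beta\in\mathbb{Z}^2\}$ (disjoint translates of six vertices), with translations $T_{\beta'}(v_j+\beta)=v_j+\beta+\beta'$; write $\omega_1=(1,0)$, $\omega_2=(0,1)$. The edges are the $\mathbb{Z}^2$-translates of the following nine edges, with the weights indicated (symmetric and constant along translates): $v_5\sim v_6$ ($\gamma_1$), $v_4\sim v_6$ ($\gamma_2$), $v_4\sim v_5$ ($\gamma_3$), $v_1\sim v_2$ ($\gamma_4$), $v_2\sim v_3$ ($\gamma_5$), $v_1\sim v_3$ ($\gamma_6$), $v_3\sim v_4$ ($\gamma_7$), $v_2\sim v_6+\omega_1$ ($\gamma_8$), $v_1\sim v_5+\omega_2$ ($\gamma_9$). The condition in the claim says that $\sum_{w\sim v}\gamma_{vw}=\mu$ for every $v\in V$; it implies $\gamma_1=\gamma_4$, $\gamma_2=\gamma_5$, $\gamma_3=\gamma_6$. The permutations corresponding to rotations by $\frac{2\pi}{3}$ and $\frac{4\pi}{3}$ are the two non-trivial powers of the order-three map $(\gamma_1,\gamma_2,\gamma_3,\gamma_4,\gamma_5,\gamma_6,\gamma_7,\gamma_8,\gamma_9)\mapsto(\gamma_2,\gamma_3,\gamma_1,\gamma_5,\gamma_6,\gamma_4,\gamma_9,\gamma_7,\gamma_8)$. Flat bands: for $\theta\in\mathbb{R}^2$ let $\ell^2(V)_\theta=\{f:V\to\mathbb{C}: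 f(T_\beta v)=e^{i\langle\theta,\beta\rangle}f(v)\ \text{for all } v,\beta\}$ (6-dimensional) and let $\Delta_\gamma^\theta$ be the operator on $\ell^2(V)_\theta$ given by the same formula as $\Delta_\gamma$. With $w=e^{i\theta_1}$, $z=e^{i\theta_2}$ it is represented by $$\Delta_\gamma^\theta=\mathrm{Id}-\frac1\mu\begin{pmatrix}0&\gamma_4&\gamma_6&0&z\gamma_9&0\\ \gamma_4&0&\gamma_5&0&0&w\gamma_8\\ \gamma_6&\gamma_5&0&\gamma_7&0&0\\ 0&0&\gamma_7&0&\gamma_3&\gamma_2\\ \overline z\gamma_9&0&0&\gamma_3&0&\gamma_1\\ 0&\overline w\gamma_8&0&\gamma_2&\gamma_1&0\end{pmatrix}.$$ $\Delta_\gamma$ has a flat band at energy $E\in\mathbb{R}$ if $E\in\sigma(\Delta_\gamma^\theta)$ for all $\theta$ (equivalently, there is an infinite orthonormal family of eigenfunctions of $\Delta_\gamma$ in $\ell^2(V)$ to the eigenvalue $E$). The number of flat bands is the number of such energies $E$. *)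

theory Defs
  imports "HOL-Analysis.Analysis"
begin

section \<open>The Super-Kagome lattice\<close>

datatype site = V1 | V2 | V3 | V4 | V5 | V6

type_synonym vertex = "site \<times> (int \<times> int)"

fun translate :: "int \<times> int \<Rightarrow> vertex \<Rightarrow> vertex" where
  "translate \<beta>' (j, \<beta>) = (j, \<beta> + \<beta>')"

text \<open>
  The weights \<open>(\<gamma>\<^sub>1, \<dots>, \<gamma>\<^sub>9)\<close> form a vector in \<open>real ^ 9\<close>. The elements
  \<open>1, \<dots>, 9\<close> of the index type \<open>9\<close> are pairwise distinct, with \<open>9 = 0\<close>.

  \<open>edge i v w\<close> means that \<open>v\<close> and \<open>w\<close> are joined by an edge of the \<open>i\<close>-th class,
  that is, one of weight \<open>\<gamma> $ i\<close>.
\<close>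

inductive base_edge :: "9 \<Rightarrow> vertex \<Rightarrow> vertex \<Rightarrow> bool" where
  "base_edge 1 (V5, \<beta>) (V6, \<beta>)"
| "base_edge 2 (V4, \<beta>) (V6, \<beta>)"
| "base_edge 3 (V4, \<beta>) (V5, \<beta>)"
| "base_edge 4 (V1, \<beta>) (V2, \<beta>)"
| "base_edge 5 (V2, \<beta>) (V3, \<beta>)"
| "base_edge 6 (V1, \<beta>) (V3, \<beta>)"
| "base_edge 7 (V3, \<beta>) (V4, \<beta>)"
| "base_edge 8 (V2, \<beta>) (V6, \<beta> + (1, 0))"
| "base_edge 9 (V1, \<beta>) (V5, \<beta> + (0, 1))"

definition edge :: "9 \<Rightarrow> vertex \<Rightarrow> vertex \<Rightarrow> bool" where
  "edge i v w \<longleftrightarrow> base_edge i v w \<or> base_edge i w v"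

definition adjacent :: "vertex \<Rightarrow> vertex \<Rightarrow> bool" where
  "adjacent v w \<longleftrightarrow> (\<exists>i. edge i v w)"

text \<open>For adjacent vertices the sum has exactly one term.\<close>

definition edge_weight :: "real ^ 9 \<Rightarrow> vertex \<Rightarrow> vertex \<Rightarrow> real" where
  "edge_weight \<gamma> v w = (\<Sum>i | edge i v w. \<gamma> $ i)"

definition admissible_weights :: "real \<Rightarrow> (real ^ 9) set" where
  "admissible_weights \<mu> = {\<gamma>. (\<forall>i. \<gamma> $ i > 0) \<and>
     \<gamma> $ 2 + \<gamma> $ 3 + \<gamma> $ 7 = \<mu> \<and> \<gamma> $ 5 + \<gamma> $ 6 + \<gamma> $ 7 = \<mu> \<and>
     \<gamma> $ 1 + \<gamma> $ 2 + \<gamma> $ 8 = \<mu> \<and> \<gamma> $ 4 + \<gamma> $ 5 + \<gamma> $ 8 = \<mu> \<and>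
     \<gamma> $ 1 + \<gamma> $ 3 + \<gamma> $ 9 = \<mu> \<and> \<gamma> $ 4 + \<gamma> $ 6 + \<gamma> $ 9 = \<mu>}"


section \<open>Laplacian and flat bands\<close>

text \<open>
  Every vertex has only three neighbours, so the formula makes sense for every function on the
  vertices; it gives both the operator on square-summable functions and the operators on the
  spaces \<open>bloch_space \<theta>\<close> below.
\<close>

definition laplacian :: "real \<Rightarrow> real ^ 9 \<Rightarrow> (vertex \<Rightarrow> complex) \<Rightarrow> vertex \<Rightarrow> complex" where
  "laplacian \<mu> \<gamma> f v =
     f v - complex_of_real (1 / \<mu>) * (\<Sum>w | adjacent v w. complex_of_real (edge_weight \<gamma> v w) * f w)"

definition bloch_space :: "real \<times> real \<Rightarrow> (vertex \<Rightarrow> complex) set" where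
  "bloch_space \<theta> = {f. \<forall>v \<beta>. f (translate \<beta> v) =
     exp (\<i> * complex_of_real (fst \<theta> * of_int (fst \<beta>) + snd \<theta> * of_int (snd \<beta>))) * f v}"

text \<open>The spectrum of an operator \<open>A\<close> restricted to an invariant finite-dimensional space \<open>Q\<close>.\<close>

definition spectrum_on ::
  "(vertex \<Rightarrow> complex) set \<Rightarrow> ((vertex \<Rightarrow> complex) \<Rightarrow> vertex \<Rightarrow> complex) \<Rightarrow> complex set" where
  "spectrum_on Q A = {E. \<not> bij_betw (\<lambda>f v. A f v - E * f v) Q Q}"

definition flat_band :: "real \<Rightarrow> real ^ 9 \<Rightarrow> real \<Rightarrow> bool" where
  "flat_band \<mu> \<gamma> E \<longleftrightarrow>
     (\<forall>\<theta>. complex_of_real E \<in> spectrum_on (bloch_space \<theta>) (laplacian \<mu> \<gamma>))"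

definition one_flat_band_weights :: "real \<Rightarrow> (real ^ 9) set" where
  "one_flat_band_weights \<mu> = {\<gamma> \<in> admissible_weights \<mu>. card {E. flat_band \<mu> \<gamma> E} = 1}"

definition two_flat_band_weights :: "real \<Rightarrow> (real ^ 9) set" where
  "two_flat_band_weights \<mu> = {vector [\<alpha>, \<alpha>, \<alpha>, \<alpha>, \<alpha>, \<alpha>, \<beta>, \<beta>, \<beta>] | \<alpha> \<beta>.
     \<alpha> > 0 \<and> \<beta> > 0 \<and> 2 * \<alpha> + \<beta> = \<mu>}"


section \<open>Rotations\<close>

definition rotate_weights :: "real ^ 9 \<Rightarrow> real ^ 9" where
  "rotate_weights \<gamma> =
     vector [\<gamma> $ 2, \<gamma> $ 3, \<gamma> $ 1, \<gamma> $ 5, \<gamma> $ 6, \<gamma> $ 4, \<gamma> $ 9, \<gamma> $ 7, \<gamma> $ 8]"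

definition rotation_orbit :: "(real ^ 9) set \<Rightarrow> (real ^ 9) set set" where
  "rotation_orbit C = {C, rotate_weights ` C, (rotate_weights \<circ> rotate_weights) ` C}"


section \<open>One-dimensional submanifolds\<close>

text \<open>Infinitely often differentiable; \<open>D n\<close> is the \<open>n\<close>-th derivative of \<open>f\<close>.\<close>

definition smooth_curve_on :: "real set \<Rightarrow> (real \<Rightarrow> 'a::real_normed_vector) \<Rightarrow> bool" where
  "smooth_curve_on I f \<longleftrightarrow> (\<exists>D. (\<forall>t\<in>I. D 0 t = f t) \<and>
     (\<forall>n. \<forall>t\<in>I. (D n has_vector_derivative D (Suc n) t) (at t)))"

text \<open>Smooth embeddings of an open set of reals: immersions that are homeomorphisms onto their image.\<close>

definition smooth_embedding_on :: "real set \<Rightarrow> (real \<Rightarrow> 'a::real_normed_vector) \<Rightarrow> bool" where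
  "smooth_embedding_on I f \<longleftrightarrow> open I \<and> smooth_curve_on I f \<and>
     (\<forall>t\<in>I. vector_derivative f (at t) \<noteq> 0) \<and> (\<exists>g. homeomorphism I (f ` I) f g)"

definition one_dim_submanifold :: "'a::real_normed_vector set \<Rightarrow> bool" where
  "one_dim_submanifold M \<longleftrightarrow>
     (\<forall>p\<in>M. \<exists>U I f. open U \<and> p \<in> U \<and> smooth_embedding_on I f \<and> f ` I = M \<inter> U)"

text \<open>A diffeomorphism from an interval onto a submanifold is the same as an embedding of that
  interval with the submanifold as its image.\<close>

definition isomorphic_to_interval :: "'a::real_normed_vector set \<Rightarrow> bool" where
  "isomorphic_to_interval M \<longleftrightarrow>
     (\<exists>a b f. a < b \<and> smooth_embedding_on {a<..<b} f \<and> f ` {a<..<b} = M)"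


section \<open>The curves of weights\<close>

definition curve1 :: "real \<Rightarrow> (real ^ 9) set" where
  "curve1 \<mu> = (\<lambda>\<alpha>.
     let \<beta> = \<mu> - 3 * \<alpha> + sqrt (17 * \<alpha>\<^sup>2 - 8 * \<alpha> * \<mu>);
         \<gamma>\<^sub>1 = (\<mu> - \<beta>) / 2; \<gamma>\<^sub>2 = \<alpha>; \<gamma>\<^sub>3 = (\<mu> - \<beta>) / 2;
         \<gamma>\<^sub>7 = (\<mu> + \<beta>) / 2 - \<alpha>; \<gamma>\<^sub>8 = (\<mu> + \<beta>) / 2 - \<alpha>; \<gamma>\<^sub>9 = \<beta>
     in vector [\<gamma>\<^sub>1, \<gamma>\<^sub>2, \<gamma>\<^sub>3, \<gamma>\<^sub>1, \<gamma>\<^sub>2, \<gamma>\<^sub>3, \<gamma>\<^sub>7, \<gamma>\<^sub>8, \<gamma>\<^sub>9]) ` {\<mu> / 2<..<\<mu>}"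

definition curve2a :: "real \<Rightarrow> (real ^ 9) set" where
  "curve2a \<mu> = (\<lambda>\<alpha>.
     let \<beta> = \<mu> + 3 * \<alpha> - sqrt (9 * \<alpha>\<^sup>2 + 8 * \<alpha> * \<mu>);
         \<gamma>\<^sub>1 = (\<mu> - \<beta>) / 2; \<gamma>\<^sub>2 = \<alpha>; \<gamma>\<^sub>3 = (\<mu> - \<beta>) / 2;
         \<gamma>\<^sub>7 = (\<mu> + \<beta>) / 2 - \<alpha>; \<gamma>\<^sub>8 = (\<mu> + \<beta>) / 2 - \<alpha>; \<gamma>\<^sub>9 = \<beta>
     in vector [\<gamma>\<^sub>1, \<gamma>\<^sub>2, \<gamma>\<^sub>3, \<gamma>\<^sub>1, \<gamma>\<^sub>2, \<gamma>\<^sub>3, \<gamma>\<^sub>7, \<gamma>\<^sub>8, \<gamma>\<^sub>9]) ` {0<..<\<mu> / 2}"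

definition curve2b :: "real \<Rightarrow> (real ^ 9) set" where
  "curve2b \<mu> = (\<lambda>\<alpha>.
     let \<beta> = (\<mu> - 3 * \<alpha> + sqrt (\<mu>\<^sup>2 - 2 * \<alpha> * \<mu> + 5 * \<alpha>\<^sup>2)) / 2;
         \<gamma>\<^sub>1 = \<alpha>; \<gamma>\<^sub>2 = \<alpha> * \<beta> / (\<alpha> + \<beta>); \<gamma>\<^sub>3 = \<beta>;
         \<gamma>\<^sub>7 = \<mu> - (2 * \<alpha> * \<beta> + \<beta>\<^sup>2) / (\<alpha> + \<beta>);
         \<gamma>\<^sub>8 = \<mu> - (\<alpha>\<^sup>2 + 2 * \<alpha> * \<beta>) / (\<alpha> + \<beta>);
         \<gamma>\<^sub>9 = \<mu> - \<alpha> - \<beta>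
     in vector [\<gamma>\<^sub>1, \<gamma>\<^sub>2, \<gamma>\<^sub>3, \<gamma>\<^sub>1, \<gamma>\<^sub>2, \<gamma>\<^sub>3, \<gamma>\<^sub>7, \<gamma>\<^sub>8, \<gamma>\<^sub>9]) ` {0<..<\<mu>}"


section \<open>Basic facts\<close>

lemma vector_9 [simp]:
  fixes a b c d e f g h i :: "'a::zero"
  defines "v \<equiv> vector [a, b, c, d, e, f, g, h, i] :: 'a ^ 9"
  shows "v $ 1 = a" "v $ 2 = b" "v $ 3 = c" "v $ 4 = d" "v $ 5 = e" "v $ 6 = f"
    "v $ 7 = g" "v $ 8 = h" "v $ 9 = i"
  unfolding v_def vector_def by simp_all

lemma edge_simps:
  "edge i (V1, \<beta>) w \<longleftrightarrow> i = 4 \<and> w = (V2, \<beta>) \<or> i = 6 \<and> w = (V3, \<beta>) \<or> i = 9 \<and> w = (V5, \<beta> + (0, 1))"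
  "edge i (V2, \<beta>) w \<longleftrightarrow> i = 4 \<and> w = (V1, \<beta>) \<or> i = 5 \<and> w = (V3, \<beta>) \<or> i = 8 \<and> w = (V6, \<beta> + (1, 0))"
  "edge i (V3, \<beta>) w \<longleftrightarrow> i = 6 \<and> w = (V1, \<beta>) \<or> i = 5 \<and> w = (V2, \<beta>) \<or> i = 7 \<and> w = (V4, \<beta>)"
  "edge i (V4, \<beta>) w \<longleftrightarrow> i = 7 \<and> w = (V3, \<beta>) \<or> i = 3 \<and> w = (V5, \<beta>) \<or> i = 2 \<and> w = (V6, \<beta>)"
  "edge i (V5, \<beta>) w \<longleftrightarrow> i = 9 \<and> w = (V1, \<beta> - (0, 1)) \<or> i = 3 \<and> w = (V4, \<beta>) \<or> i = 1 \<and> w = (V6, \<beta>)"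
  "edge i (V6, \<beta>) w \<longleftrightarrow> i = 8 \<and> w = (V2, \<beta> - (1, 0)) \<or> i = 2 \<and> w = (V4, \<beta>) \<or> i = 1 \<and> w = (V5, \<beta>)"
  unfolding edge_def base_edge.simps by (cases \<beta>; auto)+

lemma sum_adjacent:
  fixes \<gamma> :: "real ^ 9" and g :: "real \<Rightarrow> vertex \<Rightarrow> 'a::comm_monoid_add"
  defines "s \<equiv> \<lambda>v. \<Sum>w | adjacent v w. g (edge_weight \<gamma> v w) w"
  shows
    "s (V1, \<beta>) = g (\<gamma> $ 4) (V2, \<beta>) + (g (\<gamma> $ 6) (V3, \<beta>) + g (\<gamma> $ 9) (V5, \<beta> + (0, 1)))"
    "s (V2, \<beta>) = g (\<gamma> $ 4) (V1, \<beta>) + (g (\<gamma> $ 5) (V3, \<beta>) + g (\<gamma> $ 8) (V6, \<beta> + (1, 0)))"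
    "s (V3, \<beta>) = g (\<gamma> $ 6) (V1, \<beta>) + (g (\<gamma> $ 5) (V2, \<beta>) + g (\<gamma> $ 7) (V4, \<beta>))"
    "s (V4, \<beta>) = g (\<gamma> $ 7) (V3, \<beta>) + (g (\<gamma> $ 3) (V5, \<beta>) + g (\<gamma> $ 2) (V6, \<beta>))"
    "s (V5, \<beta>) = g (\<gamma> $ 9) (V1, \<beta> - (0, 1)) + (g (\<gamma> $ 3) (V4, \<beta>) + g (\<gamma> $ 1) (V6, \<beta>))"
    "s (V6, \<beta>) = g (\<gamma> $ 8) (V2, \<beta> - (1, 0)) + (g (\<gamma> $ 2) (V4, \<beta>) + g (\<gamma> $ 1) (V5, \<beta>))"
  unfolding s_def adjacent_def edge_weight_def edge_simps ex_disj_distrib Collect_disj_eq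
  by (simp_all add: add_ac)

end

theory Submission
  imports Defs
begin

text \<open>
  The two triangles carry the same weights \<open>a, b, c\<close>, so at energy \<open>E\<close> the Bloch matrix is a block
  matrix with diagonal blocks \<open>N = A - e\<close>, \<open>e = \<mu> (1 - E)\<close>, and off-diagonal blocks \<open>D\<close> and its
  adjoint, where \<open>D\<close> is diagonal with entries of modulus \<open>\<gamma>\<^sub>9, \<gamma>\<^sub>8, \<gamma>\<^sub>7\<close>. Its determinant is a
  Laurent polynomial in the phases; the vanishing of the non-constant coefficients says that
  \<open>e = \<plusminus> \<gamma>\<^sub>7 - bc/a = \<plusminus> \<gamma>\<^sub>8 - ab/c = \<plusminus> \<gamma>\<^sub>9 - ac/b\<close>, and the constant coefficient then vanishes
  automatically. Three equal signs force \<open>a = b = c\<close>, which gives two flat bands. Each of the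
  six mixed sign patterns determines \<open>e\<close> uniquely and is a relatively closed condition, the six are
  mutually exclusive, and a rotation by \<open>2\<pi>/3\<close> permutes the signs cyclically. Hence they cut out
  the six components, and elementary algebra identifies two of them with the stated curves.
\<close>

section \<open>Rational curves and components\<close>

lemma has_vector_derivative_vec_lambda:
  fixes f :: "'n::finite \<Rightarrow> real \<Rightarrow> real"
  assumes "\<And>i. (f i has_real_derivative f' i) (at t)"
  shows "((\<lambda>s. \<chi> i. f i s) has_vector_derivative (\<chi> i. f' i)) (at t)"
proof -
  have expand: "(\<chi> i. h i) = (\<Sum>i\<in>UNIV. h i *\<^sub>R axis i 1)" for h :: "'n \<Rightarrow> real"
    using basis_expansion[of "\<chi> i. h i"] by (simp add: scalar_mult_eq_scaleR)
  show ?thesis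
    unfolding expand
    using assms
    by (intro has_vector_derivative_sum)
       (auto intro: has_vector_derivative_scaleR[where g = "\<lambda>_. _" and g' = 0, simplified])
qed

text \<open>Numerator of the n-th derivative of \<open>p / q\<close> over the denominator
  \<open>q ^ Suc n\<close>. Each quotient rule produces a common factor \<open>q ^ n\<close>, which
  is cancelled.\<close>

primrec iterated_numerator :: "real poly \<Rightarrow> real poly \<Rightarrow> nat \<Rightarrow> real poly" where
  "iterated_numerator q p 0 = p"
| "iterated_numerator q p (Suc n) =
     pderiv (iterated_numerator q p n) * q - of_nat (Suc n) * iterated_numerator q p n * pderiv q"

lemma iterated_numerator_derivative:
  assumes "poly q t \<noteq> 0"
  shows "((\<lambda>s. poly (iterated_numerator q p n) s / poly q s ^ Suc n) has_real_derivative
    poly (iterated_numerator q p (Suc n)) t / poly q t ^ Suc (Suc n)) (at t)"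
proof -
  define u v w where "u = poly q t" and "v = poly (iterated_numerator q p n) t"
    and "w = poly (pderiv (iterated_numerator q p n)) t"
  have "((\<lambda>s. poly (iterated_numerator q p n) s / poly q s ^ Suc n) has_real_derivative
    (w * u ^ Suc n - v * (of_nat (Suc n) * (poly (pderiv q) t * u ^ n))) / (u ^ Suc n * u ^ Suc n)) (at t)"
    unfolding u_def v_def w_def of_nat_Suc
    by (rule DERIV_divide[OF poly_DERIV DERIV_power_Suc[OF poly_DERIV]]) (use assms in simp)
  also have "w * u ^ Suc n - v * (of_nat (Suc n) * (poly (pderiv q) t * u ^ n)) =
      u ^ n * (w * u - of_nat (Suc n) * v * poly (pderiv q) t)"
    by (simp add: algebra_simps del: of_nat_Suc)
  also have "\<dots> / (u ^ Suc n * u ^ Suc n) =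
      (w * u - of_nat (Suc n) * v * poly (pderiv q) t) / u ^ Suc (Suc n)"
    using assms by (simp add: u_def del: of_nat_Suc)
  also have "w * u - of_nat (Suc n) * v * poly (pderiv q) t = poly (iterated_numerator q p (Suc n)) t"
    by (simp add: u_def v_def w_def of_nat_poly del: of_nat_Suc)
  finally show ?thesis
    by (simp only: u_def)
qed

text \<open>A common denominator for all coordinates makes every derivative explicit, which supplies
  the whole sequence \<open>D\<close> at once.\<close>

lemma rational_curve_smooth:
  fixes f :: "real \<Rightarrow> real ^ 'n::finite"
  assumes f: "\<And>t i. t \<in> I \<Longrightarrow> f t $ i = poly (p i) t / poly q t"
    and q: "\<And>t. t \<in> I \<Longrightarrow> poly q t \<noteq> 0"
  shows "smooth_curve_on I f"
proof -
  define D :: "nat \<Rightarrow> real \<Rightarrow> real ^ 'n" where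
    "D n t = (\<chi> i. poly (iterated_numerator q (p i) n) t / poly q t ^ Suc n)" for n t
  have "D 0 t = f t" if "t \<in> I" for t
    using f[OF that] by (simp add: D_def vec_eq_iff)
  moreover have "(D n has_vector_derivative D (Suc n) t) (at t)" if "t \<in> I" for n t
    unfolding D_def[abs_def]
    by (intro has_vector_derivative_vec_lambda iterated_numerator_derivative q that)
  ultimately show ?thesis
    unfolding smooth_curve_on_def by (intro exI[of _ D]) auto
qed

text \<open>The parameter is recovered as the quotient \<open>k / l\<close> of two linear functionals. This yields the
  continuous inverse, and differentiating \<open>k (f t) = t * l (f t)\<close> shows that \<open>f\<close> is an immersion.\<close>

lemma smooth_embedding_onI:
  fixes k l :: "'a::real_normed_vector \<Rightarrow> real"
  assumes I: "open I" and f: "smooth_curve_on I f"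
    and k: "bounded_linear k" and l: "bounded_linear l"
    and kl: "\<And>t. t \<in> I \<Longrightarrow> k (f t) = t * l (f t)"
    and l0: "\<And>t. t \<in> I \<Longrightarrow> l (f t) \<noteq> 0"
  shows "smooth_embedding_on I f"
proof -
  obtain D where D0: "\<And>t. t \<in> I \<Longrightarrow> D 0 t = f t"
    and DS: "\<And>n t. t \<in> I \<Longrightarrow> (D n has_vector_derivative D (Suc n) t) (at t)"
    using f unfolding smooth_curve_on_def by blast
  have deriv: "(f has_vector_derivative D 1 t) (at t)" if "t \<in> I" for t
    using has_vector_derivative_transform_within_open[OF DS[OF that, of 0] I that D0] by simp
  have "vector_derivative f (at t) \<noteq> 0" if t: "t \<in> I" for t
  proof
    assume "vector_derivative f (at t) = 0"
    then have f0: "(f has_vector_derivative 0) (at t)"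
      using deriv[OF t] vector_derivative_at by metis
    have k0: "((\<lambda>s. k (f s)) has_vector_derivative 0) (at t)"
      and l1: "((\<lambda>s. l (f s)) has_vector_derivative 0) (at t)"
      using bounded_linear.has_vector_derivative[OF k f0]
        bounded_linear.has_vector_derivative[OF l f0]
      by (simp_all add: linear_0 bounded_linear.linear k l)
    have "((\<lambda>s. s * l (f s)) has_vector_derivative l (f t)) (at t)"
      using has_vector_derivative_mult[OF has_vector_derivative_id l1] by simp
    then have "((\<lambda>s. k (f s)) has_vector_derivative l (f t)) (at t)"
      by (rule has_vector_derivative_transform_within_open[OF _ I t]) (simp add: kl)
    then show False
      using k0 l0[OF t] vector_derivative_unique_at by metis
  qed
  moreover have "homeomorphism I (f ` I) f (\<lambda>x. k x / l x)"
  proof (rule homeomorphismI)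
    show "continuous_on I f"
      using deriv has_vector_derivative_continuous continuous_at_imp_continuous_on by blast
    show "continuous_on (f ` I) (\<lambda>x. k x / l x)"
      using l0 by (intro continuous_on_divide linear_continuous_on k l) auto
  qed (use kl l0 in \<open>auto simp: field_simps\<close>)
  ultimately show ?thesis
    unfolding smooth_embedding_on_def using I f by blast
qed

text \<open>One global chart suffices at every point: take \<open>U = UNIV\<close>.\<close>

lemma isomorphic_to_interval_imp_one_dim_submanifold:
  assumes "isomorphic_to_interval M"
  shows "one_dim_submanifold M"
  using assms unfolding isomorphic_to_interval_def one_dim_submanifold_def
  by (metis IntI Int_UNIV_right UNIV_I open_UNIV)

lemma isomorphic_to_interval_imp_connected:
  assumes "isomorphic_to_interval M"
  shows "connected M"
proof -
  obtain a b f where "smooth_embedding_on {a<..<b} f" and M: "f ` {a<..<b} = M"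
    using assms unfolding isomorphic_to_interval_def by blast
  then have "continuous_on {a<..<b} f"
    unfolding smooth_embedding_on_def homeomorphism_def by blast
  then show ?thesis
    using M connected_continuous_image[of "{a<..<b}" f] by simp
qed

text \<open>The complement of a piece in \<open>S\<close> is a finite union of relatively closed
  pieces, so each piece is clopen in \<open>S\<close>. A nonempty clopen subset of a connected set
  is the whole set, hence each piece is a maximal connected subset.\<close>

lemma components_eqI:
  assumes fin: "finite F" and S: "\<Union>F = S" and disj: "pairwise disjnt F"
    and conn: "\<And>C. C \<in> F \<Longrightarrow> connected C \<and> C \<noteq> {}"
    and clos: "\<And>C. C \<in> F \<Longrightarrow> closedin (top_of_set S) C"
  shows "components S = F"
proof -
  have C: "C \<in> components S" if "C \<in> F" for C
    unfolding in_components_maximal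
  proof (intro conjI allI impI)
    show "C \<noteq> {}" "connected C" "C \<subseteq> S"
      using conn S that by auto
    fix T assume T: "T \<noteq> {} \<and> C \<subseteq> T \<and> T \<subseteq> S \<and> connected T"
    have "closedin (top_of_set S) (\<Union>(F - {C}))"
      using fin clos by (intro closedin_Union) auto
    moreover have "C = S - \<Union>(F - {C})"
      using S disj that unfolding pairwise_def disjnt_def by blast
    ultimately have "openin (top_of_set S) C"
      by (metis openin_diff openin_subtopology_self)
    then have "openin (top_of_set T) C" "closedin (top_of_set T) C"
      using T clos[OF that] by (auto intro: openin_subset_trans closedin_subset_trans)
    then show "T = C"
      using T \<open>C \<noteq> {}\<close> unfolding connected_clopen by blast
  qed
  moreover have "D \<in> F" if D: "D \<in> components S" for D
  proof -
    obtain x where "x \<in> D" "x \<in> S"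
      using D in_components_nonempty in_components_subset by blast
    then obtain E where "E \<in> F" "x \<in> E"
      using S by blast
    then show ?thesis
      using components_nonoverlap[OF D C] \<open>x \<in> D\<close> by blast
  qed
  ultimately show ?thesis by blast
qed

section \<open>Reduction to six dimensions\<close>

lemma UNIV_site: "UNIV = {V1, V2, V3, V4, V5, V6}"
  using site.exhaust by auto

instance site :: finite
  by standard (simp add: UNIV_site)

section \<open>Bloch functions as vectors on one cell\<close>

definition phase :: "real \<times> real \<Rightarrow> int \<times> int \<Rightarrow> complex" where
  "phase \<theta> \<beta> = exp (\<i> * complex_of_real (fst \<theta> * of_int (fst \<beta>) + snd \<theta> * of_int (snd \<beta>)))"

lemma phase_add: "phase \<theta> (\<beta> + \<beta>') = phase \<theta> \<beta> * phase \<theta> \<beta>'"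
  by (simp add: phase_def exp_add[symmetric] algebra_simps)

lemma phase_zero [simp]: "phase \<theta> 0 = 1"
  by (simp add: phase_def)

lemma phase_nonzero [simp]: "phase \<theta> \<beta> \<noteq> 0"
  by (simp add: phase_def)

lemma phase_minus: "phase \<theta> (- \<beta>) = 1 / phase \<theta> \<beta>"
  using phase_add[of \<theta> \<beta> "- \<beta>"] by (simp add: field_simps)

lemma phase_diff: "phase \<theta> (\<beta> - \<beta>') = phase \<theta> \<beta> * (1 / phase \<theta> \<beta>')"
  using phase_add[of \<theta> \<beta> "- \<beta>'"] by (simp add: phase_minus)

definition bloch_extend :: "real \<times> real \<Rightarrow> complex ^ site \<Rightarrow> vertex \<Rightarrow> complex" where
  "bloch_extend \<theta> x = (\<lambda>(j, \<beta>). phase \<theta> \<beta> * x $ j)"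

lemma bloch_extend_simp [simp]: "bloch_extend \<theta> x (j, \<beta>) = phase \<theta> \<beta> * x $ j"
  by (simp add: bloch_extend_def)

lemma bloch_space_eq:
  "bloch_space \<theta> = {f. \<forall>v \<beta>. f (translate \<beta> v) = phase \<theta> \<beta> * f v}"
  by (simp only: bloch_space_def phase_def)

text \<open>A quasi-periodic function is determined by its six values on the cell at the origin, and
  these can be prescribed freely.\<close>

lemma bij_betw_bloch_extend: "bij_betw (bloch_extend \<theta>) UNIV (bloch_space \<theta>)"
proof (rule bij_betwI[where g = "\<lambda>f. \<chi> j. f (j, 0)"])
  have "bloch_extend \<theta> x (translate \<beta> v) = phase \<theta> \<beta> * bloch_extend \<theta> x v" for x \<beta> v
    by (cases v) (simp only: translate.simps bloch_extend_simp phase_add mult_ac)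
  then show "bloch_extend \<theta> \<in> UNIV \<rightarrow> bloch_space \<theta>"
    unfolding bloch_space_eq by blast
  fix f assume f: "f \<in> bloch_space \<theta>"
  have "bloch_extend \<theta> (\<chi> j. f (j, 0)) (j, \<beta>) = f (j, \<beta>)" for j \<beta>
  proof -
    have "f (translate \<beta> (j, 0)) = phase \<theta> \<beta> * f (j, 0)"
      using f unfolding bloch_space_eq by blast
    then show ?thesis
      by (simp only: translate.simps add_0 bloch_extend_simp vec_lambda_beta)
  qed
  then show "bloch_extend \<theta> (\<chi> j. f (j, 0)) = f"
    by (simp only: fun_eq_iff split_paired_All[of "\<lambda>v. _ v = f v"]) blast
qed (auto simp: vec_eq_iff)

lemmas sum_adjacent_weighted =
  sum_adjacent[where g = "\<lambda>e w. complex_of_real e * f w" and 'a = complex for f]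

text \<open>The 6 x 6 Bloch matrix minus \<open>E\<close>, kept as a map so that it can be read off
  from \<open>laplacian\<close> directly.\<close>

definition bloch_operator ::
  "real \<Rightarrow> real ^ 9 \<Rightarrow> real \<times> real \<Rightarrow> complex \<Rightarrow> complex ^ site \<Rightarrow> complex ^ site" where
  "bloch_operator \<mu> \<gamma> \<theta> E x = (\<chi> j. laplacian \<mu> \<gamma> (bloch_extend \<theta> x) (j, 0) - E * x $ j)"

lemma laplacian_bloch_extend:
  "laplacian \<mu> \<gamma> (bloch_extend \<theta> x) (j, \<beta>) =
    phase \<theta> \<beta> * laplacian \<mu> \<gamma> (bloch_extend \<theta> x) (j, 0)"
  by (cases j; simp only: laplacian_def sum_adjacent_weighted bloch_extend_simp phase_add phase_diff phase_zero)
    (simp_all add: phase_minus algebra_simps)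

lemma bloch_operator_extend:
  "(\<lambda>v. laplacian \<mu> \<gamma> (bloch_extend \<theta> x) v - E * bloch_extend \<theta> x v) =
    bloch_extend \<theta> (bloch_operator \<mu> \<gamma> \<theta> E x)"
proof
  fix v :: vertex
  show "laplacian \<mu> \<gamma> (bloch_extend \<theta> x) v - E * bloch_extend \<theta> x v =
    bloch_extend \<theta> (bloch_operator \<mu> \<gamma> \<theta> E x) v"
  proof -
    obtain j \<beta> where "v = (j, \<beta>)"
      by (cases v)
    then show ?thesis
      using laplacian_bloch_extend[of \<mu> \<gamma> \<theta> x j \<beta>]
      by (simp add: bloch_operator_def right_diff_distrib mult.left_commute)
  qed
qed

text \<open>Linearity over the reals is enough: \<open>complex ^ site\<close> is a
  finite-dimensional real space, so injectivity of the map implies surjectivity.\<close>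

lemma linear_bloch_operator: "linear (bloch_operator \<mu> \<gamma> \<theta> E)"
proof (rule linearI)
  fix x y :: "complex ^ site" and s :: real
  have "laplacian \<mu> \<gamma> (bloch_extend \<theta> (x + y)) (j, 0) =
    laplacian \<mu> \<gamma> (bloch_extend \<theta> x) (j, 0) + laplacian \<mu> \<gamma> (bloch_extend \<theta> y) (j, 0)" for j
    by (cases j; simp only: laplacian_def sum_adjacent_weighted) (simp_all add: algebra_simps)
  then show "bloch_operator \<mu> \<gamma> \<theta> E (x + y) =
      bloch_operator \<mu> \<gamma> \<theta> E x + bloch_operator \<mu> \<gamma> \<theta> E y"
    by (simp add: bloch_operator_def vec_eq_iff algebra_simps)
  have "laplacian \<mu> \<gamma> (bloch_extend \<theta> (s *\<^sub>R x)) (j, 0) =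
    s *\<^sub>R laplacian \<mu> \<gamma> (bloch_extend \<theta> x) (j, 0)" for j
    by (cases j; simp only: laplacian_def sum_adjacent_weighted bloch_extend_simp
      vector_scaleR_component) (simp_all add: algebra_simps scaleR_conv_of_real)
  then show "bloch_operator \<mu> \<gamma> \<theta> E (s *\<^sub>R x) = s *\<^sub>R bloch_operator \<mu> \<gamma> \<theta> E x"
    by (simp add: bloch_operator_def vec_eq_iff scaleR_diff_right)
qed

text \<open>Conjugation by \<open>bloch_extend\<close> moves the problem to a finite-dimensional
  space, where failing to be bijective means having a nonzero kernel vector.\<close>

lemma in_spectrum_on_bloch_space_iff:
  "E \<in> spectrum_on (bloch_space \<theta>) (laplacian \<mu> \<gamma>) \<longleftrightarrow>
    (\<exists>x\<noteq>0. bloch_operator \<mu> \<gamma> \<theta> E x = 0)"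
proof -
  let ?e = "bloch_extend \<theta>" and ?L = "bloch_operator \<mu> \<gamma> \<theta> E"
  let ?T = "\<lambda>f v. laplacian \<mu> \<gamma> f v - E * f v"
  have "bij_betw ?T (bloch_space \<theta>) (bloch_space \<theta>) \<longleftrightarrow> bij_betw (?T \<circ> ?e) UNIV (bloch_space \<theta>)"
    using bij_betw_bloch_extend by (rule bij_betw_comp_iff)
  also have "?T \<circ> ?e = ?e \<circ> ?L"
    by (simp add: fun_eq_iff bloch_operator_extend[THEN fun_cong, simplified])
  also have "bij_betw (?e \<circ> ?L) UNIV (bloch_space \<theta>) \<longleftrightarrow> bij ?L"
    using bij_betw_comp_iff2[OF bij_betw_bloch_extend, of ?L UNIV] by simp
  also have "bij ?L \<longleftrightarrow> inj ?L"
    using linear_injective_imp_surjective[OF linear_bloch_operator] by (metis bij_def)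
  also have "\<dots> \<longleftrightarrow> (\<forall>x. ?L x = 0 \<longrightarrow> x = 0)"
    using linear_injective_0[OF linear_bloch_operator] by blast
  finally show ?thesis
    unfolding spectrum_on_def by auto
qed

text \<open>Here \<open>ev\<close> is the eigenvalue of the weighted adjacency operator. The rows of
  \<open>V5\<close> and \<open>V6\<close> are multiplied by their phases, which avoids inverse
  phases.\<close>

lemma bloch_operator_eq_0_iff:
  fixes \<mu> E :: real and \<gamma> :: "real ^ 9"
  assumes "\<mu> \<noteq> 0"
  defines "ev \<equiv> complex_of_real (\<mu> * (1 - E))"
  defines "g \<equiv> \<lambda>i. complex_of_real (\<gamma> $ i)"
  shows "bloch_operator \<mu> \<gamma> \<theta> (complex_of_real E) x = 0 \<longleftrightarrow>
    ev * x $ V1 = g 4 * x $ V2 + g 6 * x $ V3 + g 9 * phase \<theta> (0, 1) * x $ V5 \<and>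
    ev * x $ V2 = g 4 * x $ V1 + g 5 * x $ V3 + g 8 * phase \<theta> (1, 0) * x $ V6 \<and>
    ev * x $ V3 = g 6 * x $ V1 + g 5 * x $ V2 + g 7 * x $ V4 \<and>
    ev * x $ V4 = g 7 * x $ V3 + g 3 * x $ V5 + g 2 * x $ V6 \<and>
    phase \<theta> (0, 1) * (ev * x $ V5) =
      g 9 * x $ V1 + phase \<theta> (0, 1) * (g 3 * x $ V4 + g 1 * x $ V6) \<and>
    phase \<theta> (1, 0) * (ev * x $ V6) =
      g 8 * x $ V2 + phase \<theta> (1, 0) * (g 2 * x $ V4 + g 1 * x $ V5)"
proof -
  have all: "(\<forall>j. P j) \<longleftrightarrow> P V1 \<and> P V2 \<and> P V3 \<and> P V4 \<and> P V5 \<and> P V6" for P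
    by (metis site.exhaust)
  have row: "u - complex_of_real (1 / \<mu>) * s - complex_of_real E * u = 0 \<longleftrightarrow> ev * u = s" for u s
    using assms(1) by (auto simp: ev_def field_simps)
  have row': "h * (ev * u) = s1 + h * s2 \<longleftrightarrow> ev * u = (1 / h) * s1 + s2"
    if "h \<noteq> 0" for h u s1 s2
    using that by (auto simp: field_simps)
  show ?thesis
    unfolding vec_eq_iff all bloch_operator_def row'[OF phase_nonzero] laplacian_def
      vec_lambda_beta zero_index bloch_extend_simp phase_zero mult_1 row sum_adjacent_weighted
      phase_diff add_0
    by (simp add: g_def distrib_left mult_ac add_ac)
qed

section \<open>The flat band condition\<close>

text \<open>Determinant of the symmetric 3 x 3 matrix with diagonal \<open>x, y, z\<close> and
  off-diagonal entries \<open>a\<close> (1,2), \<open>b\<close> (2,3) and \<open>c\<close>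
  (1,3).\<close>

definition triangle_det :: "'a::comm_ring_1 \<Rightarrow> 'a \<Rightarrow> 'a \<Rightarrow> 'a \<Rightarrow> 'a \<Rightarrow> 'a \<Rightarrow> 'a" where
  "triangle_det a b c x y z = x * y * z + 2 * a * b * c - x * b\<^sup>2 - y * c\<^sup>2 - z * a\<^sup>2"

lemma triangle_det_eq_0:
  fixes a b c :: "'a::idom"
  assumes "x * u + a * v + c * w = 0" "a * u + y * v + b * w = 0" "c * u + b * v + z * w = 0"
    and "u \<noteq> 0 \<or> v \<noteq> 0 \<or> w \<noteq> 0"
  shows "triangle_det a b c x y z = 0"
proof -
  \<comment> \<open>The coefficients are the rows of the adjugate matrix: adjugate times matrix is
    the determinant times the identity.\<close>
  have "triangle_det a b c x y z * u = (y * z - b\<^sup>2) * (x * u + a * v + c * w)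
      + (b * c - a * z) * (a * u + y * v + b * w) + (a * b - c * y) * (c * u + b * v + z * w)"
    "triangle_det a b c x y z * v = (b * c - a * z) * (x * u + a * v + c * w)
      + (x * z - c\<^sup>2) * (a * u + y * v + b * w) + (a * c - b * x) * (c * u + b * v + z * w)"
    "triangle_det a b c x y z * w = (a * b - c * y) * (x * u + a * v + c * w)
      + (a * c - b * x) * (a * u + y * v + b * w) + (x * y - a\<^sup>2) * (c * u + b * v + z * w)"
    unfolding triangle_det_def by (simp_all add: algebra_simps power2_eq_square)
  then show ?thesis
    using assms by auto
qed

lemma triangle_det_of_real:
  "triangle_det (complex_of_real a) (of_real b) (of_real c) (of_real x) (of_real y) (of_real z) =
    of_real (triangle_det a b c x y z)"
  by (simp add: triangle_det_def)

text \<open>The function \<open>P d\<^sub>1 d\<^sub>2 d\<^sub>3\<close> is \<open>det (N + D) * det (N - D)\<close> for \<open>N\<close> the weighted triangle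
  minus \<open>e\<close> and \<open>D = diag (d\<^sub>1, d\<^sub>2, d\<^sub>3)\<close>. Its four values under sign changes of \<open>d\<^sub>1, d\<^sub>2\<close>
  determine the coefficients of the characteristic polynomial as a Laurent polynomial in the phases.\<close>

lemma laurent_coefficients:
  fixes a b c e p q r :: real
  defines "P \<equiv> \<lambda>x y z. triangle_det a b c (x - e) (y - e) (z - e) *
    triangle_det a b c (- x - e) (- y - e) (- z - e)"
  assumes P: "P r q p = 0" "P (- r) q p = 0" "P r (- q) p = 0" "P (- r) (- q) p = 0"
    and pos: "p \<noteq> 0" "q \<noteq> 0" "r \<noteq> 0"
  shows "(a * e + b * c)\<^sup>2 = (a * p)\<^sup>2" "(c * e + a * b)\<^sup>2 = (c * q)\<^sup>2"
    "(b * e + a * c)\<^sup>2 = (b * r)\<^sup>2"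
proof -
  \<comment> \<open>\<open>P\<close> is unchanged when all three arguments change sign. A signed sum
    of its four values keeps the part of one parity in the first two arguments, here odd in both;
    the next two sums isolate the other mixed parities.\<close>
  have "8 * r * q * ((a * p)\<^sup>2 - (a * e + b * c)\<^sup>2) =
      P r q p - P (- r) q p - P r (- q) p + P (- r) (- q) p"
    unfolding P_def triangle_det_def by algebra
  with P pos show "(a * e + b * c)\<^sup>2 = (a * p)\<^sup>2"
    by simp
  have "8 * r * p * ((c * q)\<^sup>2 - (c * e + a * b)\<^sup>2) =
      P r q p - P (- r) q p + P r (- q) p - P (- r) (- q) p"
    unfolding P_def triangle_det_def by algebra
  with P pos show "(c * e + a * b)\<^sup>2 = (c * q)\<^sup>2"
    by simp
  have "8 * q * p * ((b * r)\<^sup>2 - (b * e + a * c)\<^sup>2) =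
      P r q p + P (- r) q p - P r (- q) p - P (- r) (- q) p"
    unfolding P_def triangle_det_def by algebra
  with P pos show "(b * e + a * c)\<^sup>2 = (b * r)\<^sup>2"
    by simp
qed

lemma admissible_weights_equal_triangles:
  assumes "\<gamma> \<in> admissible_weights \<mu>"
  shows "\<gamma> $ 4 = \<gamma> $ 1" "\<gamma> $ 5 = \<gamma> $ 2" "\<gamma> $ 6 = \<gamma> $ 3"
  using assms unfolding admissible_weights_def by auto

lemma phase_real:
  fixes s t :: bool
  defines "sgn' \<equiv> \<lambda>b::bool. if b then - 1 else (1 :: complex)"
  defines "\<theta> \<equiv> (if s then pi else 0, if t then pi else 0 :: real)"
  shows "phase \<theta> (1, 0) = sgn' s" "phase \<theta> (0, 1) = sgn' t"
  by (simp_all add: phase_def \<theta>_def sgn'_def)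

text \<open>With real phases both off-diagonal blocks are the same diagonal matrix \<open>D\<close>.
  Sums and differences over the pairs \<open>V1, V5\<close>, \<open>V2, V6\<close> and
  \<open>V3, V4\<close> then decouple the system into \<open>N + D\<close> and \<open>N - D\<close>,
  and a nonzero \<open>x\<close> has a nonzero sum or difference.\<close>

lemma kernel_imp_triangle_det:
  fixes a b c e p z w :: real and x :: "complex ^ site"
  defines "A \<equiv> complex_of_real a" and "B \<equiv> complex_of_real b" and "C \<equiv> complex_of_real c"
  assumes x: "x \<noteq> 0"
    and eqs: "of_real e * x $ V1 = A * x $ V2 + C * x $ V3 + of_real z * x $ V5"
      "of_real e * x $ V2 = A * x $ V1 + B * x $ V3 + of_real w * x $ V6"
      "of_real e * x $ V3 = C * x $ V1 + B * x $ V2 + of_real p * x $ V4"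
      "of_real e * x $ V4 = of_real p * x $ V3 + C * x $ V5 + B * x $ V6"
      "of_real e * x $ V5 = of_real z * x $ V1 + C * x $ V4 + A * x $ V6"
      "of_real e * x $ V6 = of_real w * x $ V2 + B * x $ V4 + A * x $ V5"
  shows "triangle_det a b c (z - e) (w - e) (p - e) *
    triangle_det a b c (- z - e) (- w - e) (- p - e) = 0"
proof -
  define u v where "u = (\<lambda>i j. x $ i + x $ j)" and "v = (\<lambda>i j. x $ i - x $ j)"
  have plus: "triangle_det A B C (of_real (z - e)) (of_real (w - e)) (of_real (p - e)) = 0"
    if "u V1 V5 \<noteq> 0 \<or> u V2 V6 \<noteq> 0 \<or> u V3 V4 \<noteq> 0"
    by (rule triangle_det_eq_0[OF _ _ _ that])
      (use eqs in \<open>simp_all add: u_def algebra_simps\<close>)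
  have minus: "triangle_det A B C (of_real (- z - e)) (of_real (- w - e)) (of_real (- p - e)) = 0"
    if "v V1 V5 \<noteq> 0 \<or> v V2 V6 \<noteq> 0 \<or> v V3 V4 \<noteq> 0"
    by (rule triangle_det_eq_0[OF _ _ _ that])
      (use eqs in \<open>simp_all add: v_def algebra_simps\<close>)
  have "\<exists>j. x $ j \<noteq> 0"
    using x by (simp add: vec_eq_iff)
  then have "x $ V1 \<noteq> 0 \<or> x $ V2 \<noteq> 0 \<or> x $ V3 \<noteq> 0 \<or> x $ V4 \<noteq> 0 \<or> x $ V5 \<noteq> 0 \<or> x $ V6 \<noteq> 0"
    by (metis site.exhaust)
  then have "u V1 V5 \<noteq> 0 \<or> u V2 V6 \<noteq> 0 \<or> u V3 V4 \<noteq> 0 \<or> v V1 V5 \<noteq> 0 \<or> v V2 V6 \<noteq> 0 \<or> v V3 V4 \<noteq> 0"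
    unfolding u_def v_def by (auto simp: add_eq_0_iff)
  then show ?thesis
    using plus minus unfolding A_def B_def C_def triangle_det_of_real of_real_eq_0_iff by auto
qed

text \<open>The variable \<open>e\<close> stands for \<open>\<mu> * (1 - E)\<close>. Squaring covers
  both signs in each condition, and the denominators are cleared.\<close>

definition flat_eigenvalue :: "real ^ 9 \<Rightarrow> real \<Rightarrow> bool" where
  "flat_eigenvalue \<gamma> e \<longleftrightarrow>
     (\<gamma> $ 1 * e + \<gamma> $ 2 * \<gamma> $ 3)\<^sup>2 = (\<gamma> $ 1 * \<gamma> $ 7)\<^sup>2 \<and>
     (\<gamma> $ 3 * e + \<gamma> $ 1 * \<gamma> $ 2)\<^sup>2 = (\<gamma> $ 3 * \<gamma> $ 8)\<^sup>2 \<and>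
     (\<gamma> $ 2 * e + \<gamma> $ 1 * \<gamma> $ 3)\<^sup>2 = (\<gamma> $ 2 * \<gamma> $ 9)\<^sup>2"

text \<open>Only the four momenta with coordinates 0 or pi are used. Their phases are signs and give
  exactly the four sign changes of \<open>\<gamma> $ 9\<close> and \<open>\<gamma> $ 8\<close> that
  \<open>laurent_coefficients\<close> requires.\<close>

lemma flat_band_imp_flat_eigenvalue:
  assumes \<mu>: "\<mu> > 0" and adm: "\<gamma> \<in> admissible_weights \<mu>" and flat: "flat_band \<mu> \<gamma> E"
  shows "flat_eigenvalue \<gamma> (\<mu> * (1 - E))"
proof -
  let ?P = "\<lambda>z w p. triangle_det (\<gamma> $ 1) (\<gamma> $ 2) (\<gamma> $ 3) (z - \<mu> * (1 - E)) (w - \<mu> * (1 - E)) (p - \<mu> * (1 - E)) *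
    triangle_det (\<gamma> $ 1) (\<gamma> $ 2) (\<gamma> $ 3) (- z - \<mu> * (1 - E)) (- w - \<mu> * (1 - E)) (- p - \<mu> * (1 - E))"
  have sgn: "?P ((if t then - 1 else 1) * \<gamma> $ 9) ((if s then - 1 else 1) * \<gamma> $ 8) (\<gamma> $ 7) = 0" for s t
  proof -
    let ?\<theta> = "(if s then pi else 0, if t then pi else 0)"
    obtain x where x: "x \<noteq> 0" "bloch_operator \<mu> \<gamma> ?\<theta> (complex_of_real E) x = 0"
      using flat unfolding flat_band_def in_spectrum_on_bloch_space_iff by blast
    show ?thesis
      by (rule kernel_imp_triangle_det[OF x(1)])
        (use x(2) \<mu> in \<open>auto simp: bloch_operator_eq_0_iff phase_real
          admissible_weights_equal_triangles[OF adm] algebra_simps minus_equation_iff split: if_splits\<close>)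
  qed
  have "\<gamma> $ 7 \<noteq> 0" "\<gamma> $ 8 \<noteq> 0" "\<gamma> $ 9 \<noteq> 0"
    using adm unfolding admissible_weights_def by (auto simp: less_imp_neq[symmetric])
  then show ?thesis
    unfolding flat_eigenvalue_def
    using laurent_coefficients[of "\<gamma> $ 1" "\<gamma> $ 2" "\<gamma> $ 3" "\<gamma> $ 9" "\<mu> * (1 - E)" "\<gamma> $ 8" "\<gamma> $ 7"]
      sgn[of False False] sgn[of True False] sgn[of False True] sgn[of True True]
    by simp
qed

section \<open>Sufficiency of the eigenvalue condition\<close>

text \<open>At a flat eigenvalue \<open>e\<close>, the weighted triangle minus \<open>e\<close> is a rank one matrix with range
  spanned by \<open>n = (ac, ab, bc)\<close> minus a diagonal matrix whose entries are \<open>\<gamma>\<^sub>9, \<gamma>\<^sub>8, \<gamma>\<^sub>7\<close> up to sign.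
  So one looks for a kernel vector \<open>(U g, g)\<close> with \<open>U\<close> diagonal and unitary and both \<open>g\<close> and
  \<open>U g\<close> orthogonal to \<open>n\<close>: two linear equations in three unknowns.\<close>

lemma exists_orthogonal_pair:
  fixes n1 n2 n3 u1 u2 u3 :: "'a::idom"
  assumes "n1 \<noteq> 0" "n2 \<noteq> 0" "n3 \<noteq> 0"
  obtains g1 g2 g3 where "g1 \<noteq> 0 \<or> g2 \<noteq> 0 \<or> g3 \<noteq> 0"
    "n1 * g1 + n2 * g2 + n3 * g3 = 0"
    "n1 * (u1 * g1) + n2 * (u2 * g2) + n3 * (u3 * g3) = 0"
proof (cases "u1 = u2 \<and> u2 = u3")
  case True
  show ?thesis
    by (rule that[of n2 "- n1" 0]) (use assms True in \<open>simp_all add: mult_ac\<close>)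
next
  case False
  \<comment> \<open>The witness is the cross product of the two coefficient vectors; it is nonzero
    because the \<open>u\<close>s are not all equal.\<close>
  show ?thesis
    by (rule that[of "n2 * n3 * (u3 - u2)" "n1 * n3 * (u1 - u3)" "n1 * n2 * (u2 - u1)"])
      (use assms False in \<open>auto simp: algebra_simps\<close>)
qed

text \<open>One row of the rank one decomposition. The other rows arise by permuting
  \<open>a, b, c\<close>.\<close>

lemma triangle_row_on_orthogonal:
  fixes a b c :: "'a::field"
  assumes "a * c * f + a * b * g + b * c * h = 0" "b \<noteq> 0" "b * e + a * c = b * d"
  shows "e * f = a * g + c * h + d * f"
proof -
  have "b * (e * f - (a * g + c * h + d * f)) = (b * e + a * c - b * d) * f
      - (a * c * f + a * b * g + b * c * h)"
    by (simp add: algebra_simps)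
  then show ?thesis
    using assms by simp
qed

lemma flat_eigenvalue_imp_flat_band:
  assumes \<mu>: "\<mu> > 0" and adm: "\<gamma> \<in> admissible_weights \<mu>"
    and flat: "flat_eigenvalue \<gamma> (\<mu> * (1 - E))"
  shows "flat_band \<mu> \<gamma> E"
  unfolding flat_band_def in_spectrum_on_bloch_space_iff
proof
  fix \<theta> :: "real \<times> real"
  define a b c p q r e where "a = complex_of_real (\<gamma> $ 1)" "b = complex_of_real (\<gamma> $ 2)"
    "c = complex_of_real (\<gamma> $ 3)" "p = complex_of_real (\<gamma> $ 7)" "q = complex_of_real (\<gamma> $ 8)"
    "r = complex_of_real (\<gamma> $ 9)" "e = complex_of_real (\<mu> * (1 - E))"
  note defs = this
  define z w where zw: "z = phase \<theta> (0, 1)" "w = phase \<theta> (1, 0)"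
  have nz: "a \<noteq> 0" "b \<noteq> 0" "c \<noteq> 0" "z \<noteq> 0" "w \<noteq> 0"
    using adm by (auto simp: defs zw admissible_weights_def less_imp_neq[symmetric])
  have sign: "\<exists>s. s * s = 1 \<and> complex_of_real x * of_real l + of_real m = of_real x * (s * of_real y)"
    if "(x * l + m)\<^sup>2 = (x * y)\<^sup>2" for x l m y
  proof -
    have "x * l + m = x * y \<or> x * l + m = - (x * y)"
      using that by (simp add: power2_eq_iff)
    then have "complex_of_real x * of_real l + of_real m = of_real x * (1 * of_real y) \<or>
        complex_of_real x * of_real l + of_real m = of_real x * ((- 1) * of_real y)"
      by (metis mult_1 mult_minus_left mult_minus_right of_real_add of_real_minus of_real_mult)
    then show ?thesis
      using square_eq_1_iff by blast
  qed
  obtain s7 s8 s9 where s: "s7 * s7 = 1" "s8 * s8 = 1" "s9 * s9 = 1"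
    and s7: "a * e + b * c = a * (s7 * p)"
    and s8: "c * e + a * b = c * (s8 * q)"
    and s9: "b * e + a * c = b * (s9 * r)"
    using flat sign[of "\<gamma> $ 1" "\<mu> * (1 - E)"] sign[of "\<gamma> $ 3" "\<mu> * (1 - E)"]
      sign[of "\<gamma> $ 2" "\<mu> * (1 - E)"]
    unfolding flat_eigenvalue_def defs of_real_mult[of "\<gamma> $ _", symmetric] by blast
  obtain g1 g2 g3 where g: "g1 \<noteq> 0 \<or> g2 \<noteq> 0 \<or> g3 \<noteq> 0"
    and ng: "a * c * g1 + a * b * g2 + b * c * g3 = 0"
    and nf: "a * c * (s9 * z * g1) + a * b * (s8 * w * g2) + b * c * (s7 * g3) = 0"
    using exists_orthogonal_pair[of "a * c" "a * b" "b * c" "s9 * z" "s8 * w" s7] nz by auto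
  \<comment> \<open>The diagonal of \<open>U\<close> is \<open>s9 * z\<close>,
    \<open>s8 * w\<close>, \<open>s7\<close>: the phases absorb the shifts between cells, and since
    the signs square to 1 they turn the true couplings into the signed ones in
    \<open>rows\<close>.\<close>
  define x :: "complex ^ site" where "x = (\<chi> j. case j of
    V1 \<Rightarrow> s9 * z * g1 | V2 \<Rightarrow> s8 * w * g2 | V3 \<Rightarrow> s7 * g3 | V4 \<Rightarrow> g3 | V5 \<Rightarrow> g1 | V6 \<Rightarrow> g2)"
  have x: "x $ V1 = s9 * z * g1" "x $ V2 = s8 * w * g2" "x $ V3 = s7 * g3"
    "x $ V4 = g3" "x $ V5 = g1" "x $ V6 = g2"
    by (simp_all add: x_def)
  have rows: "e * f1 = a * f2 + c * f3 + s9 * r * f1" "e * f2 = a * f1 + b * f3 + s8 * q * f2"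
    "e * f3 = b * f2 + c * f1 + s7 * p * f3"
    if "a * c * f1 + a * b * f2 + b * c * f3 = 0" for f1 f2 f3
    using triangle_row_on_orthogonal[of a c f1 b f2 f3 e "s9 * r"]
      triangle_row_on_orthogonal[of a b f2 c f1 f3 e "s8 * q"]
      triangle_row_on_orthogonal[of b c f3 a f2 f1 e "s7 * p"] that nz s7 s8 s9
    by (simp_all add: mult_ac add_ac)
  have "bloch_operator \<mu> \<gamma> \<theta> (complex_of_real E) x = 0"
    unfolding bloch_operator_eq_0_iff[OF less_imp_neq[OF \<mu>, symmetric]]
      admissible_weights_equal_triangles[OF adm] defs[symmetric] zw[symmetric] x
    using rows[OF ng] rows[OF nf] s by (simp add: algebra_simps)
  moreover have "x \<noteq> 0"
    using g x by auto
  ultimately show "\<exists>x\<noteq>0. bloch_operator \<mu> \<gamma> \<theta> (complex_of_real E) x = 0"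
    by blast
qed

lemma flat_band_iff:
  assumes "\<mu> > 0" "\<gamma> \<in> admissible_weights \<mu>"
  shows "flat_band \<mu> \<gamma> E \<longleftrightarrow> flat_eigenvalue \<gamma> (\<mu> * (1 - E))"
  using assms flat_band_imp_flat_eigenvalue flat_eigenvalue_imp_flat_band by blast

section \<open>Sign patterns\<close>

text \<open>The signs \<open>s, t, u\<close> belong to \<open>\<gamma> $ 7\<close>,
  \<open>\<gamma> $ 8\<close>, \<open>\<gamma> $ 9\<close>. Equating the three resulting expressions
  for \<open>e\<close> eliminates \<open>e\<close>.\<close>

definition sign_set :: "real \<Rightarrow> real \<Rightarrow> real \<Rightarrow> real \<Rightarrow> (real ^ 9) set" where
  "sign_set \<mu> s t u = {\<gamma> \<in> admissible_weights \<mu>.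
     s * \<gamma> $ 7 - \<gamma> $ 2 * \<gamma> $ 3 / \<gamma> $ 1 = t * \<gamma> $ 8 - \<gamma> $ 1 * \<gamma> $ 2 / \<gamma> $ 3 \<and>
     t * \<gamma> $ 8 - \<gamma> $ 1 * \<gamma> $ 2 / \<gamma> $ 3 = u * \<gamma> $ 9 - \<gamma> $ 1 * \<gamma> $ 3 / \<gamma> $ 2}"

lemma admissible_weights_pos:
  assumes "\<gamma> \<in> admissible_weights \<mu>"
  shows "\<gamma> $ i > 0"
  using assms by (simp add: admissible_weights_def)

lemma flat_eigenvalue_iff:
  assumes "\<gamma> \<in> admissible_weights \<mu>"
  shows "flat_eigenvalue \<gamma> e \<longleftrightarrow> (\<exists>s\<in>{1, -1}. \<exists>t\<in>{1, -1}. \<exists>u\<in>{1, -1}.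
    e = s * \<gamma> $ 7 - \<gamma> $ 2 * \<gamma> $ 3 / \<gamma> $ 1 \<and> e = t * \<gamma> $ 8 - \<gamma> $ 1 * \<gamma> $ 2 / \<gamma> $ 3 \<and>
    e = u * \<gamma> $ 9 - \<gamma> $ 1 * \<gamma> $ 3 / \<gamma> $ 2)"
proof -
  have "(x * e + m)\<^sup>2 = (x * y)\<^sup>2 \<longleftrightarrow> (\<exists>s\<in>{1, -1}. e = s * y - m / x)"
    if "x > 0" for x y m :: real
    using that unfolding power2_eq_iff by (auto simp: field_simps)
  then show ?thesis
    using admissible_weights_pos[OF assms] unfolding flat_eigenvalue_def by auto
qed

text \<open>The balance conditions supply \<open>p - q = a - c\<close>, so the difference of the two
  sides has the factor \<open>a - c\<close>, and the cofactor is positive.\<close>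

lemma same_sign_plus_iff:
  fixes a b c p q :: real
  assumes "a > 0" "b > 0" "c > 0" "p - q = a - c"
  shows "p - b * c / a = q - a * b / c \<longleftrightarrow> a = c"
proof -
  have q: "q = p - a + c"
    using assms by simp
  have "p - b * c / a - (q - a * b / c) = (a - c) * (a * c + b * (a + c)) / (a * c)"
    using assms(1-3) by (simp add: q field_simps)
  moreover have "a * c + b * (a + c) > 0"
    using assms by (simp add: add_pos_pos)
  ultimately show ?thesis
    using assms(1-3) by (subst eq_iff_diff_eq_0) simp
qed

text \<open>For negative signs the cofactor \<open>a * c - b * (a + c)\<close> can vanish. This
  extra alternative is the origin of \<open>curve2b\<close>.\<close>

lemma same_sign_minus_iff:
  fixes a b c p q :: real
  assumes "a > 0" "b > 0" "c > 0" "p - q = a - c"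
  shows "- p - b * c / a = - q - a * b / c \<longleftrightarrow> a = c \<or> a * c = b * (a + c)"
proof -
  have q: "q = p - a + c"
    using assms by simp
  have "- p - b * c / a - (- q - a * b / c) = - (a - c) * (a * c - b * (a + c)) / (a * c)"
    using assms(1-3) by (simp add: q field_simps)
  then show ?thesis
    using assms(1-3) by (subst eq_iff_diff_eq_0) auto
qed

text \<open>The relation says \<open>1 / b = 1 / a + 1 / c\<close>.\<close>

lemma harmonic_imp_less:
  fixes a b c :: real
  assumes "a > 0" "c > 0" "a * c = b * (a + c)"
  shows "b < a \<and> b < c"
proof -
  have "b * (a + c) < a * (a + c)" "b * (a + c) < c * (a + c)"
    using assms by (simp_all add: algebra_simps)
  then show ?thesis
    using assms by simp
qed

lemma uniform_sign_imp_equal: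
  assumes "\<gamma> \<in> sign_set \<mu> s s s" "s \<in> {1, -1}"
  shows "\<gamma> $ 1 = \<gamma> $ 2 \<and> \<gamma> $ 2 = \<gamma> $ 3"
proof -
  have adm: "\<gamma> \<in> admissible_weights \<mu>"
    using assms by (simp add: sign_set_def)
  define a b c p q r where abc: "a = \<gamma> $ 1" "b = \<gamma> $ 2" "c = \<gamma> $ 3" "p = \<gamma> $ 7" "q = \<gamma> $ 8" "r = \<gamma> $ 9"
  have pos: "a > 0" "b > 0" "c > 0"
    using admissible_weights_pos[OF adm] by (simp_all add: abc)
  have d: "p - q = a - c" "p - r = a - b" "q - r = c - b"
    using adm by (auto simp: abc admissible_weights_def)
  have e: "s * p - b * c / a = s * q - a * b / c" "s * q - a * b / c = s * r - a * c / b"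
    using assms by (simp_all add: abc sign_set_def)
  show ?thesis
  proof (cases "s = 1")
    case True
    then show ?thesis
      using e same_sign_plus_iff[OF pos d(1)] same_sign_plus_iff[of c a b q r] pos d
      by (simp add: abc mult_ac)
  next
    case False
    then have s: "s = -1"
      using assms(2) by simp
    have 1: "a = c \<or> a * c = b * (a + c)"
      using e same_sign_minus_iff[OF pos d(1)] s by simp
    have 2: "c = b \<or> b * c = a * (b + c)"
      using e same_sign_minus_iff[of c a b q r] pos d s by (simp add: mult_ac add_ac)
    have 3: "a = b \<or> a * b = c * (a + b)"
      using e same_sign_minus_iff[of a c b p r] pos d s by (simp add: mult_ac add_ac)
    \<comment> \<open>A harmonic relation makes one weight strictly smaller than the other two,
      which contradicts both alternatives of another of the three facts.\<close>
    have "a = b \<and> b = c"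
      using 1 2 3 pos harmonic_imp_less by (smt (verit))
    then show ?thesis by (simp add: abc)
  qed
qed

text \<open>A second eigenvalue would carry all three opposite signs. Adding the two families of
  equations cancels the signed terms and forces \<open>a = b = c\<close>, hence
  \<open>p = q = r\<close>, and then the original signs agree.\<close>

lemma mixed_sign_flat_eigenvalue_unique:
  assumes \<gamma>: "\<gamma> \<in> sign_set \<mu> s t u" and signs: "s \<in> {1, -1}" "t \<in> {1, -1}" "u \<in> {1, -1}"
    and mixed: "\<not> (s = t \<and> t = u)"
  shows "flat_eigenvalue \<gamma> e \<longleftrightarrow> e = s * \<gamma> $ 7 - \<gamma> $ 2 * \<gamma> $ 3 / \<gamma> $ 1"
proof
  have adm: "\<gamma> \<in> admissible_weights \<mu>"
    using assms by (simp add: sign_set_def)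
  let ?e = "s * \<gamma> $ 7 - \<gamma> $ 2 * \<gamma> $ 3 / \<gamma> $ 1"
  define a b c p q r where abc: "a = \<gamma> $ 1" "b = \<gamma> $ 2" "c = \<gamma> $ 3" "p = \<gamma> $ 7" "q = \<gamma> $ 8" "r = \<gamma> $ 9"
  have pos: "a > 0" "b > 0" "c > 0" "p > 0"
    using admissible_weights_pos[OF adm] by (simp_all add: abc)
  have d: "p - q = a - c" "p - r = a - b"
    using adm by (auto simp: abc admissible_weights_def)
  have e: "s * p - b * c / a = t * q - a * b / c" "t * q - a * b / c = u * r - a * c / b"
    using assms by (simp_all add: abc sign_set_def)
  show "flat_eigenvalue \<gamma> e" if "e = ?e"
    using \<gamma> signs unfolding flat_eigenvalue_iff[OF adm] sign_set_def that
    by (intro bexI[of _ s] bexI[of _ t] bexI[of _ u]) simp_all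
  assume "flat_eigenvalue \<gamma> e"
  then obtain s' t' u' where s': "s' \<in> {1, -1}" "t' \<in> {1, -1}" "u' \<in> {1, -1}"
    and e': "e = s' * p - b * c / a" "e = t' * q - a * b / c" "e = u' * r - a * c / b"
    unfolding flat_eigenvalue_iff[OF adm] abc by blast
  show "e = ?e"
  proof (rule ccontr)
    assume ne: "e \<noteq> ?e"
    have "e \<noteq> s * p - b * c / a" "e \<noteq> t * q - a * b / c" "e \<noteq> u * r - a * c / b"
      using ne e by (simp_all add: abc)
    then have "s' \<noteq> s" "t' \<noteq> t" "u' \<noteq> u"
      using e' by metis+
    then have "s' = - s" "t' = - t" "u' = - u"
      using s' signs by auto
    then have "b * c / a = a * b / c" "a * b / c = a * c / b"
      using e e' by auto
    then have "c * c = a * a" "b * b = c * c"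
      using pos by (auto simp: field_simps)
    then have "a = b" "b = c"
      using pos by (auto simp: square_eq_iff)
    then have "s * p = t * p" "t * p = u * p"
      using e d pos by auto
    then show False
      using mixed pos by auto
  qed
qed

lemma two_flat_eigenvalues_if_equal:
  assumes adm: "\<gamma> \<in> admissible_weights \<mu>" and eq: "\<gamma> $ 1 = \<gamma> $ 2" "\<gamma> $ 2 = \<gamma> $ 3"
  shows "flat_eigenvalue \<gamma> (\<gamma> $ 7 - \<gamma> $ 1)" "flat_eigenvalue \<gamma> (- \<gamma> $ 7 - \<gamma> $ 1)"
proof -
  have "\<gamma> $ 8 = \<gamma> $ 7" "\<gamma> $ 9 = \<gamma> $ 7" "\<gamma> $ 3 > 0"
    using adm eq by (auto simp: admissible_weights_def)
  then show "flat_eigenvalue \<gamma> (\<gamma> $ 7 - \<gamma> $ 1)" "flat_eigenvalue \<gamma> (- \<gamma> $ 7 - \<gamma> $ 1)"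
    unfolding flat_eigenvalue_iff[OF adm] using eq by auto
qed

text \<open>Flat bands correspond to flat eigenvalues under an affine bijection. A uniform sign
  pattern forces three equal weights and thus two flat eigenvalues, so exactly the mixed patterns
  remain.\<close>

lemma one_flat_band_weights_iff:
  assumes \<mu>: "\<mu> > 0"
  shows "\<gamma> \<in> one_flat_band_weights \<mu> \<longleftrightarrow> (\<exists>s\<in>{1, -1}. \<exists>t\<in>{1, -1}. \<exists>u\<in>{1, -1}.
    \<not> (s = t \<and> t = u) \<and> \<gamma> \<in> sign_set \<mu> s t u)" (is "_ \<longleftrightarrow> ?mixed")
proof (cases "\<gamma> \<in> admissible_weights \<mu>")
  case False
  then show ?thesis
    by (auto simp: one_flat_band_weights_def sign_set_def)
next
  case adm: True
  have "{E. flat_band \<mu> \<gamma> E} = (\<lambda>e. 1 - e / \<mu>) ` {e. flat_eigenvalue \<gamma> e}"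
    using \<mu> unfolding flat_band_iff[OF \<mu> adm]
    by (auto simp: image_iff intro!: exI[of _ "\<mu> * (1 - _)"])
  moreover have "inj (\<lambda>e. 1 - e / \<mu>)"
    using \<mu> by (auto simp: inj_def)
  ultimately have card: "card {E. flat_band \<mu> \<gamma> E} = card {e. flat_eigenvalue \<gamma> e}"
    by (metis card_image inj_on_subset subset_UNIV)
  show ?thesis
  proof
    assume "\<gamma> \<in> one_flat_band_weights \<mu>"
    then have "card {e. flat_eigenvalue \<gamma> e} = 1"
      using card by (simp add: one_flat_band_weights_def)
    then obtain e where e: "{e. flat_eigenvalue \<gamma> e} = {e}"
      by (rule card_1_singletonE)
    then have "flat_eigenvalue \<gamma> e"
      by blast
    then obtain s t u where signs: "s \<in> {1, -1}" "t \<in> {1, -1}" "u \<in> {1, -1}"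
      and stu: "e = s * \<gamma> $ 7 - \<gamma> $ 2 * \<gamma> $ 3 / \<gamma> $ 1" "e = t * \<gamma> $ 8 - \<gamma> $ 1 * \<gamma> $ 2 / \<gamma> $ 3"
        "e = u * \<gamma> $ 9 - \<gamma> $ 1 * \<gamma> $ 3 / \<gamma> $ 2"
      unfolding flat_eigenvalue_iff[OF adm] by blast
    have stu: "\<gamma> \<in> sign_set \<mu> s t u"
      using adm stu by (simp add: sign_set_def)
    have "\<not> (s = t \<and> t = u)"
    proof
      assume "s = t \<and> t = u"
      then have "\<gamma> $ 1 = \<gamma> $ 2" "\<gamma> $ 2 = \<gamma> $ 3"
        using uniform_sign_imp_equal stu signs by blast+
      then have "\<gamma> $ 7 - \<gamma> $ 1 = - \<gamma> $ 7 - \<gamma> $ 1"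
        using two_flat_eigenvalues_if_equal[OF adm] e by (metis mem_Collect_eq singletonD)
      then show False
        using admissible_weights_pos[OF adm, of 7] by simp
    qed
    then show ?mixed
      using signs stu by blast
  next
    assume ?mixed
    then obtain s t u where "s \<in> {1, -1}" "t \<in> {1, -1}" "u \<in> {1, -1}"
      "\<not> (s = t \<and> t = u)" "\<gamma> \<in> sign_set \<mu> s t u"
      by blast
    then have "{e. flat_eigenvalue \<gamma> e} = {s * \<gamma> $ 7 - \<gamma> $ 2 * \<gamma> $ 3 / \<gamma> $ 1}"
      using mixed_sign_flat_eigenvalue_unique by blast
    then show "\<gamma> \<in> one_flat_band_weights \<mu>"
      using adm by (simp add: one_flat_band_weights_def card)
  qed
qed

lemma one_flat_band_weights_eq:
  assumes "\<mu> > 0"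
  shows "one_flat_band_weights \<mu> =
    sign_set \<mu> 1 1 (-1) \<union> sign_set \<mu> (-1) 1 1 \<union> sign_set \<mu> 1 (-1) 1 \<union>
    sign_set \<mu> (-1) (-1) 1 \<union> sign_set \<mu> 1 (-1) (-1) \<union> sign_set \<mu> (-1) 1 (-1)"
  by (rule set_eqI) (auto simp: one_flat_band_weights_iff[OF assms])

text \<open>At a common point both patterns have the same unique eigenvalue, and by positivity of
  \<open>\<gamma> $ 7\<close>, \<open>\<gamma> $ 8\<close>, \<open>\<gamma> $ 9\<close> that value
  determines each sign.\<close>

lemma sign_sets_disjoint:
  assumes signs: "s \<in> {1, -1}" "t \<in> {1, -1}" "u \<in> {1, -1}" "s' \<in> {1, -1}" "t' \<in> {1, -1}" "u' \<in> {1, -1}"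
    and mixed: "\<not> (s = t \<and> t = u)" "\<not> (s' = t' \<and> t' = u')"
    and ne: "(s, t, u) \<noteq> (s', t', u')"
  shows "disjnt (sign_set \<mu> s t u) (sign_set \<mu> s' t' u')"
proof (unfold disjnt_iff, intro allI notI)
  fix \<gamma> assume \<gamma>: "\<gamma> \<in> sign_set \<mu> s t u \<and> \<gamma> \<in> sign_set \<mu> s' t' u'"
  have pos: "\<gamma> $ i > 0" for i
    using \<gamma> admissible_weights_pos unfolding sign_set_def by blast
  have "s * \<gamma> $ 7 - \<gamma> $ 2 * \<gamma> $ 3 / \<gamma> $ 1 = s' * \<gamma> $ 7 - \<gamma> $ 2 * \<gamma> $ 3 / \<gamma> $ 1"
    using mixed_sign_flat_eigenvalue_unique[OF conjunct1[OF \<gamma>] signs(1-3) mixed(1)]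
      mixed_sign_flat_eigenvalue_unique[OF conjunct2[OF \<gamma>] signs(4-6) mixed(2)] by blast
  moreover have "s * \<gamma> $ 7 - \<gamma> $ 2 * \<gamma> $ 3 / \<gamma> $ 1 = t * \<gamma> $ 8 - \<gamma> $ 1 * \<gamma> $ 2 / \<gamma> $ 3"
    "t * \<gamma> $ 8 - \<gamma> $ 1 * \<gamma> $ 2 / \<gamma> $ 3 = u * \<gamma> $ 9 - \<gamma> $ 1 * \<gamma> $ 3 / \<gamma> $ 2"
    "s' * \<gamma> $ 7 - \<gamma> $ 2 * \<gamma> $ 3 / \<gamma> $ 1 = t' * \<gamma> $ 8 - \<gamma> $ 1 * \<gamma> $ 2 / \<gamma> $ 3"
    "t' * \<gamma> $ 8 - \<gamma> $ 1 * \<gamma> $ 2 / \<gamma> $ 3 = u' * \<gamma> $ 9 - \<gamma> $ 1 * \<gamma> $ 3 / \<gamma> $ 2"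
    using \<gamma> by (simp_all add: sign_set_def)
  ultimately have "s * \<gamma> $ 7 = s' * \<gamma> $ 7" "t * \<gamma> $ 8 = t' * \<gamma> $ 8" "u * \<gamma> $ 9 = u' * \<gamma> $ 9"
    by linarith+
  then show False
    using ne pos[of 7] pos[of 8] pos[of 9] by auto
qed

text \<open>Inside the admissible weights no denominator vanishes, so the two equations are zero
  sets of continuous functions.\<close>

lemma closedin_sign_set:
  assumes "S \<subseteq> admissible_weights \<mu>" "sign_set \<mu> s t u \<subseteq> S"
  shows "closedin (top_of_set S) (sign_set \<mu> s t u)"
proof -
  have "\<gamma> $ i \<noteq> 0" if "\<gamma> \<in> S" for \<gamma> i
    using that assms(1) admissible_weights_pos by (metis less_irrefl subsetD)
  then have "closedin (top_of_set S) {\<gamma> \<in> S.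
      s * \<gamma> $ 7 - \<gamma> $ 2 * \<gamma> $ 3 / \<gamma> $ 1 - (t * \<gamma> $ 8 - \<gamma> $ 1 * \<gamma> $ 2 / \<gamma> $ 3) = 0}"
    "closedin (top_of_set S) {\<gamma> \<in> S.
      t * \<gamma> $ 8 - \<gamma> $ 1 * \<gamma> $ 2 / \<gamma> $ 3 - (u * \<gamma> $ 9 - \<gamma> $ 1 * \<gamma> $ 3 / \<gamma> $ 2) = 0}"
    by (intro continuous_closedin_preimage_constant continuous_intros ballI; blast)+
  from closedin_Int[OF this] show ?thesis
    by (rule back_subst[of "closedin _"]) (use assms in \<open>auto simp: sign_set_def\<close>)
qed

section \<open>Rotations\<close>

lemma forall_9: "(\<forall>i::9. P i) \<longleftrightarrow> P 1 \<and> P 2 \<and> P 3 \<and> P 4 \<and> P 5 \<and> P 6 \<and> P 7 \<and> P 8 \<and> P 9"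
proof -
  have "x = 1 \<or> x = 2 \<or> x = 3 \<or> x = 4 \<or> x = 5 \<or> x = 6 \<or> x = 7 \<or> x = 8 \<or> x = 9" for x :: 9
  proof (induct x)
    case (of_int z)
    then have "z = 0 \<or> z = 1 \<or> z = 2 \<or> z = 3 \<or> z = 4 \<or> z = 5 \<or> z = 6 \<or> z = 7 \<or> z = 8"
      by auto
    then show ?case by auto
  qed
  then show ?thesis by metis
qed

lemma rotate_weights_cubed: "rotate_weights (rotate_weights (rotate_weights \<gamma>)) = \<gamma>"
  by (simp add: vec_eq_iff forall_9 rotate_weights_def)

text \<open>The signs travel with \<open>\<gamma> $ 7\<close>, \<open>\<gamma> $ 8\<close>,
  \<open>\<gamma> $ 9\<close>. One inclusion is direct; the other applies it twice, as the rotation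
  has order three.\<close>

lemma rotate_weights_sign_set: "rotate_weights ` sign_set \<mu> s t u = sign_set \<mu> u s t"
proof -
  have sub: "rotate_weights \<gamma> \<in> sign_set \<mu> u s t" if "\<gamma> \<in> sign_set \<mu> s t u" for \<gamma> s t u
    using that unfolding sign_set_def admissible_weights_def rotate_weights_def
    by (auto simp: forall_9 mult_ac add_ac)
  show ?thesis
  proof (intro equalityI subsetI)
    fix \<gamma> assume "\<gamma> \<in> sign_set \<mu> u s t"
    then have "rotate_weights (rotate_weights \<gamma>) \<in> sign_set \<mu> s t u"
      using sub by blast
    then show "\<gamma> \<in> rotate_weights ` sign_set \<mu> s t u"
      using rotate_weights_cubed by (metis image_eqI)
  qed (use sub in auto)
qed

lemma continuous_on_rotate_weights: "continuous_on A rotate_weights"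
proof -
  have "\<forall>i. continuous_on A (\<lambda>\<gamma>. rotate_weights \<gamma> $ i)"
    by (simp add: forall_9 rotate_weights_def continuous_intros)
  then show ?thesis
    using continuous_on_vec_lambda[of A "\<lambda>i \<gamma>. rotate_weights \<gamma> $ i"] by simp
qed

lemma connected_rotate_weights:
  assumes "connected C"
  shows "connected (rotate_weights ` C)"
  using assms connected_continuous_image continuous_on_rotate_weights by blast

section \<open>The curves\<close>

text \<open>Coordinates on the solutions of the vertex weight condition: one triangle determines all
  nine weights.\<close>

definition balanced_weights :: "real \<Rightarrow> real \<Rightarrow> real \<Rightarrow> real \<Rightarrow> real ^ 9" where
  "balanced_weights \<mu> a b c = vector [a, b, c, a, b, c, \<mu> - b - c, \<mu> - a - b, \<mu> - a - c]"

lemma balanced_weights_eq_iff: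
  "balanced_weights \<mu> a b c = balanced_weights \<mu> a' b' c' \<longleftrightarrow> a = a' \<and> b = b' \<and> c = c'"
  by (auto simp: balanced_weights_def vec_eq_iff forall_9)

lemma balanced_weights_admissible_iff:
  "balanced_weights \<mu> a b c \<in> admissible_weights \<mu> \<longleftrightarrow>
    a > 0 \<and> b > 0 \<and> c > 0 \<and> b + c < \<mu> \<and> a + b < \<mu> \<and> a + c < \<mu>"
  by (auto simp: balanced_weights_def admissible_weights_def forall_9)

lemma admissible_weights_balanced:
  assumes "\<gamma> \<in> admissible_weights \<mu>"
  shows "\<gamma> = balanced_weights \<mu> (\<gamma> $ 1) (\<gamma> $ 2) (\<gamma> $ 3)"
  using assms by (auto simp: balanced_weights_def admissible_weights_def vec_eq_iff forall_9)

lemma balanced_weights_smooth_embedding: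
  fixes A B C q :: "real poly" and k l :: "real ^ 9 \<Rightarrow> real"
  assumes I: "open I" and q: "\<And>t. t \<in> I \<Longrightarrow> poly q t \<noteq> 0"
    and f: "\<And>t. t \<in> I \<Longrightarrow>
      f t = balanced_weights \<mu> (poly A t / poly q t) (poly B t / poly q t) (poly C t / poly q t)"
    and k: "bounded_linear k" and l: "bounded_linear l"
    and kl: "\<And>t. t \<in> I \<Longrightarrow> k (f t) = t * l (f t)"
    and l0: "\<And>t. t \<in> I \<Longrightarrow> l (f t) \<noteq> 0"
  shows "smooth_embedding_on I f"
proof (rule smooth_embedding_onI[OF I _ k l kl l0])
  define p :: "9 \<Rightarrow> real poly" where
    "p i = (if i = 1 \<or> i = 4 then A else if i = 2 \<or> i = 5 then B else if i = 3 \<or> i = 6 then C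
      else if i = 7 then smult \<mu> q - B - C else if i = 8 then smult \<mu> q - A - B
      else smult \<mu> q - A - C)" for i
  have "\<forall>i. f t $ i = poly (p i) t / poly q t" if "t \<in> I" for t
    unfolding forall_9 f[OF that] balanced_weights_def p_def
    using q[OF that] by (simp add: diff_divide_distrib)
  then show "smooth_curve_on I f"
    using q by (intro rational_curve_smooth) auto
qed

lemma isomorphic_to_intervalI:
  assumes "a < b" "smooth_embedding_on {a<..<b} f"
  shows "isomorphic_to_interval (f ` {a<..<b})"
  using assms unfolding isomorphic_to_interval_def by blast

section \<open>Conic equations and rational parametrizations\<close>

text \<open>Each curve is given by a conic in two of the weights; projecting the conic from a point
  yields a rational parametrization.\<close>

lemma curve1_eq:
  assumes "\<mu> > 0"
  shows "curve1 \<mu> = {balanced_weights \<mu> a b a | a b.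
    balanced_weights \<mu> a b a \<in> admissible_weights \<mu> \<and> a\<^sup>2 - 3 * a * b + 2 * \<mu> * b - 2 * b\<^sup>2 = 0}"
    (is "_ = ?R")
proof (intro equalityI subsetI)
  fix \<gamma> assume "\<gamma> \<in> curve1 \<mu>"
  moreover have "curve1 \<mu> = (\<lambda>b. balanced_weights \<mu> ((3 * b - sqrt (17 * b\<^sup>2 - 8 * b * \<mu>)) / 2) b
      ((3 * b - sqrt (17 * b\<^sup>2 - 8 * b * \<mu>)) / 2)) ` {\<mu> / 2<..<\<mu>}"
    unfolding curve1_def Let_def balanced_weights_def
    by (intro image_cong refl) (simp add: vec_eq_iff forall_9 field_simps)
  ultimately obtain b where b: "\<mu> / 2 < b" "b < \<mu>"
    and \<gamma>: "\<gamma> = balanced_weights \<mu> ((3 * b - sqrt (17 * b\<^sup>2 - 8 * b * \<mu>)) / 2) b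
      ((3 * b - sqrt (17 * b\<^sup>2 - 8 * b * \<mu>)) / 2)"
    by auto
  define s where "s = sqrt (17 * b\<^sup>2 - 8 * b * \<mu>)"
  \<comment> \<open>Up to positive factors, the last three products are the differences of squares
    behind the bounds on \<open>s\<close>. With \<open>a = (3 * b - s) / 2\<close> these bounds say
    \<open>a > 0\<close>, \<open>a + b < \<mu>\<close> and \<open>2 * a < \<mu>\<close>.\<close>
  have prods: "b * (2 * b - \<mu>) > 0" "b * (\<mu> - b) > 0" "(2 * b - \<mu>) * (\<mu> - b) > 0"
    "(2 * b - \<mu>) * (4 * b + \<mu>) > 0"
    using b assms by simp_all
  then have s: "s\<^sup>2 = 17 * b\<^sup>2 - 8 * b * \<mu>" "s \<ge> 0"
    unfolding s_def by (simp_all add: algebra_simps power2_eq_square)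
  have "(3 * b)\<^sup>2 - s\<^sup>2 = 8 * (b * (\<mu> - b))"
    unfolding s(1) by (simp add: algebra_simps power2_eq_square)
  then have "s\<^sup>2 < (3 * b)\<^sup>2"
    using prods(2) by linarith
  then have "s < 3 * b"
    by (rule power2_less_imp_less) (use b assms in simp)
  moreover have "5 * b - 2 * \<mu> < s"
    by (rule power2_less_imp_less) (use prods b assms s in \<open>simp_all add: algebra_simps power2_eq_square\<close>)
  moreover have "3 * b - \<mu> < s"
    by (rule power2_less_imp_less) (use prods b assms s in \<open>simp_all add: algebra_simps power2_eq_square\<close>)
  ultimately show "\<gamma> \<in> ?R"
    using \<gamma> b assms s unfolding s_def[symmetric]
    by (intro CollectI exI[of _ "(3 * b - s) / 2"] exI[of _ b])
      (simp add: balanced_weights_admissible_iff field_simps power2_eq_square)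
next
  fix \<gamma> assume "\<gamma> \<in> ?R"
  then obtain a b where \<gamma>: "\<gamma> = balanced_weights \<mu> a b a" and pos: "a > 0" "b > 0"
    and less: "a + b < \<mu>" "2 * a < \<mu>" and eq: "a\<^sup>2 - 3 * a * b + 2 * \<mu> * b - 2 * b\<^sup>2 = 0"
    by (auto simp: balanced_weights_admissible_iff)
  \<comment> \<open>The conic can be written
    \<open>a * (a - b) + 2 * b * (\<mu> - a - b) = 0\<close>.\<close>
  have "a < b"
  proof (rule ccontr)
    assume "\<not> a < b"
    then have "a * (a - b) \<ge> 0" "b * (\<mu> - a - b) > 0"
      using pos less by simp_all
    then show False
      using eq by (simp add: algebra_simps power2_eq_square)
  qed
  then have prods: "a * (3 * b - a) > 0" "(b - a) * (2 * b - a) > 0"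
    using pos by simp_all
  have "b * \<mu> > b * b" "b * \<mu> < b * (2 * b)"
    using prods eq by (simp_all add: algebra_simps power2_eq_square)
  then have b: "b \<in> {\<mu> / 2<..<\<mu>}"
    using pos by simp
  \<comment> \<open>Since \<open>a < b\<close>, the number \<open>3 * b - 2 * a\<close> is positive,
    so \<open>a\<close> is the smaller root of the conic read as a quadratic in
    \<open>a\<close>.\<close>
  have sqrt: "sqrt (17 * b\<^sup>2 - 8 * b * \<mu>) = 3 * b - 2 * a"
    by (rule real_sqrt_unique) (use eq \<open>a < b\<close> pos in \<open>simp_all add: algebra_simps power2_eq_square\<close>)
  show "\<gamma> \<in> curve1 \<mu>"
    unfolding curve1_def Let_def \<gamma> balanced_weights_def
    by (intro image_eqI[OF _ b]) (simp only: sqrt, simp add: vec_eq_iff forall_9 field_simps)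
qed

lemma curve2a_eq:
  assumes "\<mu> > 0"
  shows "curve2a \<mu> = {balanced_weights \<mu> a b a | a b.
    balanced_weights \<mu> a b a \<in> admissible_weights \<mu> \<and> a\<^sup>2 + 3 * a * b - 2 * \<mu> * b = 0}"
    (is "_ = ?R")
proof (intro equalityI subsetI)
  fix \<gamma> assume "\<gamma> \<in> curve2a \<mu>"
  moreover have "curve2a \<mu> = (\<lambda>b. balanced_weights \<mu> ((sqrt (9 * b\<^sup>2 + 8 * b * \<mu>) - 3 * b) / 2) b
      ((sqrt (9 * b\<^sup>2 + 8 * b * \<mu>) - 3 * b) / 2)) ` {0<..<\<mu> / 2}"
    unfolding curve2a_def Let_def balanced_weights_def
    by (intro image_cong refl) (simp add: vec_eq_iff forall_9 field_simps)
  ultimately obtain b where b: "0 < b" "b < \<mu> / 2"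
    and \<gamma>: "\<gamma> = balanced_weights \<mu> ((sqrt (9 * b\<^sup>2 + 8 * b * \<mu>) - 3 * b) / 2) b
      ((sqrt (9 * b\<^sup>2 + 8 * b * \<mu>) - 3 * b) / 2)"
    by auto
  define s where "s = sqrt (9 * b\<^sup>2 + 8 * b * \<mu>)"
  have prods: "b * \<mu> > 0" "\<mu> * (\<mu> - 2 * b) > 0" "(\<mu> - 2 * b) * (\<mu> + b) > 0"
    using b assms by simp_all
  then have s: "s\<^sup>2 = 9 * b\<^sup>2 + 8 * b * \<mu>" "s \<ge> 0"
    using b assms unfolding s_def by simp_all
  have "3 * b < s"
    by (rule power2_less_imp_less) (use prods b assms s in \<open>simp_all add: algebra_simps power2_eq_square\<close>)
  moreover have "s < 2 * \<mu> + b"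
    by (rule power2_less_imp_less) (use prods b assms s in \<open>simp_all add: algebra_simps power2_eq_square\<close>)
  moreover have "s < \<mu> + 3 * b"
    by (rule power2_less_imp_less) (use prods b assms s in \<open>simp_all add: algebra_simps power2_eq_square\<close>)
  ultimately show "\<gamma> \<in> ?R"
    using \<gamma> b assms s unfolding s_def[symmetric]
    by (intro CollectI exI[of _ "(s - 3 * b) / 2"] exI[of _ b])
      (simp add: balanced_weights_admissible_iff field_simps power2_eq_square)
next
  fix \<gamma> assume "\<gamma> \<in> ?R"
  then obtain a b where \<gamma>: "\<gamma> = balanced_weights \<mu> a b a" and pos: "a > 0" "b > 0"
    and less: "a + b < \<mu>" "2 * a < \<mu>" and eq: "a\<^sup>2 + 3 * a * b - 2 * \<mu> * b = 0"
    by (auto simp: balanced_weights_admissible_iff)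
  \<comment> \<open>The conic can be written
    \<open>a * (a - b) = 2 * b * (\<mu> - 2 * a)\<close>.\<close>
  have "b * (\<mu> - 2 * a) > 0"
    using pos less by simp
  then have "a * b < a * a"
    using eq by (simp add: algebra_simps power2_eq_square)
  then have "b < a"
    using pos by simp
  then have "b * (a - b) > 0" "a * (a - b) > 0"
    using pos by simp_all
  then have "b * (2 * b) < b * \<mu>"
    using eq by (simp add: algebra_simps power2_eq_square)
  then have b: "b \<in> {0<..<\<mu> / 2}"
    using pos by simp
  have "sqrt (9 * b\<^sup>2 + 8 * b * \<mu>) = 3 * b + 2 * a"
    by (rule real_sqrt_unique) (use eq pos in \<open>simp_all add: algebra_simps power2_eq_square\<close>)
  then show "\<gamma> \<in> curve2a \<mu>"
    unfolding curve2a_def Let_def \<gamma> balanced_weights_def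
    by (intro image_eqI[OF _ b]) (simp add: vec_eq_iff forall_9 field_simps)
qed

lemma curve2b_eq:
  assumes "\<mu> > 0"
  shows "curve2b \<mu> = {balanced_weights \<mu> a b c | a b c.
    balanced_weights \<mu> a b c \<in> admissible_weights \<mu> \<and> a * c = b * (a + c) \<and> a + b + c = \<mu>}"
    (is "_ = ?R")
proof (intro equalityI subsetI)
  fix \<gamma> assume "\<gamma> \<in> curve2b \<mu>"
  then obtain a where a: "0 < a" "a < \<mu>"
    and \<gamma>: "\<gamma> = (let \<beta> = (\<mu> - 3 * a + sqrt (\<mu>\<^sup>2 - 2 * a * \<mu> + 5 * a\<^sup>2)) / 2;
         \<gamma>\<^sub>1 = a; \<gamma>\<^sub>2 = a * \<beta> / (a + \<beta>); \<gamma>\<^sub>3 = \<beta>;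
         \<gamma>\<^sub>7 = \<mu> - (2 * a * \<beta> + \<beta>\<^sup>2) / (a + \<beta>);
         \<gamma>\<^sub>8 = \<mu> - (a\<^sup>2 + 2 * a * \<beta>) / (a + \<beta>);
         \<gamma>\<^sub>9 = \<mu> - a - \<beta>
     in vector [\<gamma>\<^sub>1, \<gamma>\<^sub>2, \<gamma>\<^sub>3, \<gamma>\<^sub>1, \<gamma>\<^sub>2, \<gamma>\<^sub>3, \<gamma>\<^sub>7, \<gamma>\<^sub>8, \<gamma>\<^sub>9])"
    unfolding curve2b_def by auto
  define s where "s = sqrt (\<mu>\<^sup>2 - 2 * a * \<mu> + 5 * a\<^sup>2)"
  define c where "c = (\<mu> - 3 * a + s) / 2"
  define b where "b = a * c / (a + c)"
  \<comment> \<open>The sum of squares is the radicand; \<open>4 * a * (\<mu> - a)\<close> is its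
    excess over \<open>(3 * a - \<mu>)\<^sup>2\<close>.\<close>
  have "(\<mu> - a)\<^sup>2 + (2 * a)\<^sup>2 \<ge> 0" "a * (\<mu> - a) > 0"
    using a by simp_all
  then have s: "s\<^sup>2 = \<mu>\<^sup>2 - 2 * a * \<mu> + 5 * a\<^sup>2" "s \<ge> 0"
    unfolding s_def by (simp_all add: algebra_simps power2_eq_square)
  have "3 * a - \<mu> < s"
    by (rule power2_less_imp_less)
      (use \<open>a * (\<mu> - a) > 0\<close> s in \<open>simp_all add: algebra_simps power2_eq_square\<close>)
  then have c: "c > 0"
    by (simp add: c_def)
  then have ac: "a * c = b * (a + c)" and b: "b > 0"
    using a by (simp_all add: b_def)
  have "a * c = (\<mu> - a - c) * (a + c)"
    using s by (simp add: c_def field_simps power2_eq_square)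
  then have "b * (a + c) = (\<mu> - a - c) * (a + c)"
    using ac by simp
  then have sum: "a + b + c = \<mu>"
    using a c by simp
  have "(2 * a * c + c\<^sup>2) / (a + c) = b + c" "(a\<^sup>2 + 2 * a * c) / (a + c) = a + b"
    using a c by (simp_all add: b_def field_simps power2_eq_square)
  then have \<gamma>': "\<gamma> = balanced_weights \<mu> a b c"
    unfolding \<gamma> s_def[symmetric] c_def[symmetric] Let_def b_def[symmetric]
    by (simp add: balanced_weights_def diff_diff_eq)
  have "balanced_weights \<mu> a b c \<in> admissible_weights \<mu>"
    using sum a b c by (simp add: balanced_weights_admissible_iff)
  then show "\<gamma> \<in> ?R"
    using \<gamma>' ac sum by blast
next
  fix \<gamma> assume "\<gamma> \<in> ?R"
  then obtain a b c where \<gamma>: "\<gamma> = balanced_weights \<mu> a b c" and pos: "a > 0" "b > 0" "c > 0"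
    and eq: "a * c = b * (a + c)" and sum: "a + b + c = \<mu>"
    by (auto simp: balanced_weights_admissible_iff)
  have less: "b < a"
    using harmonic_imp_less pos eq by blast
  have a: "a \<in> {0<..<\<mu>}"
    using pos sum by simp
  \<comment> \<open>The right-hand side equals \<open>c + 2 * a - b\<close>, which is positive
    because \<open>b < a\<close>.\<close>
  have "sqrt (\<mu>\<^sup>2 - 2 * a * \<mu> + 5 * a\<^sup>2) = 2 * c + 3 * a - \<mu>"
    by (rule real_sqrt_unique)
      (use eq pos less in \<open>simp_all add: sum[symmetric] algebra_simps power2_eq_square\<close>)
  then have c: "(\<mu> - 3 * a + sqrt (\<mu>\<^sup>2 - 2 * a * \<mu> + 5 * a\<^sup>2)) / 2 = c"
    by simp
  have b: "b = a * c / (a + c)" "(2 * a * c + c\<^sup>2) / (a + c) = b + c" "(a\<^sup>2 + 2 * a * c) / (a + c) = a + b"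
    using pos eq by (simp_all add: field_simps power2_eq_square)
  show "\<gamma> \<in> curve2b \<mu>"
    unfolding curve2b_def \<gamma> balanced_weights_def
    by (intro image_eqI[OF _ a]) (simp add: c b(2,3) b(1)[symmetric] diff_diff_eq Let_def)
qed

text \<open>The conic passes through the origin, so the slope \<open>m = a / b\<close> is a
  parameter: substituting \<open>a = m * b\<close> and dividing by \<open>b\<close> leaves a linear
  equation for \<open>b\<close>. This avoids differentiating the square root.\<close>

lemma curve1_isomorphic_to_interval:
  assumes "\<mu> > 0"
  shows "isomorphic_to_interval (curve1 \<mu>)"
proof -
  define f where "f m = balanced_weights \<mu> (2 * \<mu> * m / (2 + 3 * m - m\<^sup>2))
    (2 * \<mu> / (2 + 3 * m - m\<^sup>2)) (2 * \<mu> * m / (2 + 3 * m - m\<^sup>2))" for m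
  have q: "2 + 3 * m - m\<^sup>2 > 0" if "m \<in> {0<..<1}" for m :: real
  proof -
    have "m * m < m * 1"
      using that by (intro mult_strict_left_mono) simp_all
    then show ?thesis
      using that unfolding power2_eq_square greaterThanLessThan_iff by linarith
  qed
  have "curve1 \<mu> = f ` {0<..<1}"
    unfolding curve1_eq[OF assms]
  proof (intro equalityI subsetI; (elim CollectE exE conjE imageE)?)
    fix \<gamma> a b
    assume \<gamma>: "\<gamma> = balanced_weights \<mu> a b a" and "balanced_weights \<mu> a b a \<in> admissible_weights \<mu>"
      and eq: "a\<^sup>2 - 3 * a * b + 2 * \<mu> * b - 2 * b\<^sup>2 = 0"
    then have pos: "a > 0" "b > 0" "b * (\<mu> - a - b) > 0"
      by (simp_all add: balanced_weights_admissible_iff)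
    have "a < b"
    proof (rule ccontr)
      assume "\<not> a < b"
      then have "a * (a - b) \<ge> 0"
        using pos by simp
      then show False
        using eq pos(3) by (simp add: algebra_simps power2_eq_square)
    qed
    define m where "m = a / b"
    have m: "m \<in> {0<..<1}" and a: "a = m * b"
      using pos \<open>a < b\<close> by (simp_all add: m_def)
    have "b * (b * (2 + 3 * m - m\<^sup>2)) = b * (2 * \<mu>)"
      using eq by (simp add: a algebra_simps power2_eq_square)
    then have "b * (2 + 3 * m - m\<^sup>2) = 2 * \<mu>"
      using pos by simp
    then have "2 * \<mu> / (2 + 3 * m - m\<^sup>2) = b"
      using q[OF m] by (simp add: divide_eq_eq)
    moreover have "2 * \<mu> * m / (2 + 3 * m - m\<^sup>2) = m * (2 * \<mu> / (2 + 3 * m - m\<^sup>2))"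
      by simp
    ultimately have "f m = \<gamma>"
      unfolding f_def \<gamma> a by simp
    then show "\<gamma> \<in> f ` {0<..<1}"
      using m by blast
  next
    fix \<gamma> m assume \<gamma>: "\<gamma> = f m" and m: "m \<in> {0<..<1::real}"
    define b where "b = 2 * \<mu> / (2 + 3 * m - m\<^sup>2)"
    have b: "b * (2 + 3 * m - m\<^sup>2) = 2 * \<mu>" "b > 0"
      using q[OF m] assms by (simp_all add: b_def)
    \<comment> \<open>These are \<open>2 * (\<mu> - a - b)\<close> and
      \<open>2 * (\<mu> - 2 * a)\<close> for \<open>a = m * b\<close>.\<close>
    have "b * (m * (1 - m)) > 0" "b * ((1 - m) * (2 + m)) > 0"
      using b m by simp_all
    then have "b * m - b * m * m > 0" "2 * b - b * m - b * m * m > 0"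
      by (simp_all only: algebra_simps mult_1_right mult_1_left mult_2 mult_2_right)
    moreover have "m * b > 0" "2 * b + 3 * (m * b) - b * m * m = 2 * \<mu>"
      using b m by (simp_all add: algebra_simps power2_eq_square)
    ultimately have "balanced_weights \<mu> (m * b) b (m * b) \<in> admissible_weights \<mu>"
      using b(2) unfolding balanced_weights_admissible_iff mult.commute[of b m]
      by (intro conjI) linarith+
    moreover have "(m * b)\<^sup>2 - 3 * (m * b) * b + 2 * \<mu> * b - 2 * b\<^sup>2 = 0"
      unfolding b(1)[symmetric] by (simp add: algebra_simps power2_eq_square)
    moreover have "\<gamma> = balanced_weights \<mu> (m * b) b (m * b)"
      by (simp add: \<gamma> f_def b_def mult_ac)
    ultimately show "\<gamma> \<in> {balanced_weights \<mu> a b a | a b. balanced_weights \<mu> a b a \<in> admissible_weights \<mu> \<and>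
        a\<^sup>2 - 3 * a * b + 2 * \<mu> * b - 2 * b\<^sup>2 = 0}"
      by blast
  qed
  moreover have "smooth_embedding_on {0<..<1} f"
    by (rule balanced_weights_smooth_embedding[where q = "[:2, 3, -1:]" and A = "[:0, 2 * \<mu>:]"
          and B = "[:2 * \<mu>:]" and C = "[:0, 2 * \<mu>:]" and k = "\<lambda>\<gamma>. \<gamma> $ 1" and l = "\<lambda>\<gamma>. \<gamma> $ 2"])
      (use q assms in \<open>auto simp: f_def balanced_weights_def bounded_linear_vec_nth power2_eq_square
        algebra_simps less_imp_neq[symmetric]\<close>)
  ultimately show ?thesis
    using isomorphic_to_intervalI[of 0 1 f] by simp
qed

text \<open>Projection from the origin again, now with slope \<open>m = b / a\<close>.\<close>

lemma curve2a_isomorphic_to_interval: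
  assumes "\<mu> > 0"
  shows "isomorphic_to_interval (curve2a \<mu>)"
proof -
  define f where "f m = balanced_weights \<mu> (2 * \<mu> * m / (1 + 3 * m))
    (2 * \<mu> * m\<^sup>2 / (1 + 3 * m)) (2 * \<mu> * m / (1 + 3 * m))" for m
  have "curve2a \<mu> = f ` {0<..<1}"
    unfolding curve2a_eq[OF assms]
  proof (intro equalityI subsetI; (elim CollectE exE conjE imageE)?)
    fix \<gamma> a b
    assume \<gamma>: "\<gamma> = balanced_weights \<mu> a b a" and "balanced_weights \<mu> a b a \<in> admissible_weights \<mu>"
      and eq: "a\<^sup>2 + 3 * a * b - 2 * \<mu> * b = 0"
    then have pos: "a > 0" "b > 0" "b * (\<mu> - 2 * a) > 0"
      by (simp_all add: balanced_weights_admissible_iff)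
    have "a * b < a * a"
      using pos(3) eq by (simp add: algebra_simps power2_eq_square)
    then have "b < a"
      using pos by simp
    define m where "m = b / a"
    have m: "m \<in> {0<..<1}" and b: "b = m * a"
      using pos \<open>b < a\<close> by (simp_all add: m_def)
    have "a * (a * (1 + 3 * m)) = a * (2 * \<mu> * m)"
      using eq by (simp add: b algebra_simps power2_eq_square)
    then have "a * (1 + 3 * m) = 2 * \<mu> * m"
      using pos by simp
    moreover have "1 + 3 * m \<noteq> 0"
      using m by auto
    ultimately have "2 * \<mu> * m / (1 + 3 * m) = a"
      by (simp add: divide_eq_eq)
    moreover have "2 * \<mu> * m\<^sup>2 / (1 + 3 * m) = m * (2 * \<mu> * m / (1 + 3 * m))"
      by (simp add: power2_eq_square)
    ultimately have "f m = \<gamma>"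
      unfolding f_def \<gamma> b by simp
    then show "\<gamma> \<in> f ` {0<..<1}"
      using m by blast
  next
    fix \<gamma> m assume \<gamma>: "\<gamma> = f m" and m: "m \<in> {0<..<1::real}"
    define a where "a = 2 * \<mu> * m / (1 + 3 * m)"
    define k where "k = 2 * \<mu> / (1 + 3 * m)"
    have k: "k * (1 + 3 * m) = 2 * \<mu>" "k > 0" and a: "a = k * m"
      using m assms by (simp_all add: k_def a_def)
    have "k * ((1 - m) * (1 + 2 * m)) > 0" "k * (1 - m) > 0"
      using k m by simp_all
    then have "k + k * m - 2 * (k * m * m) > 0" "k - k * m > 0"
      by (simp_all only: algebra_simps mult_1_right mult_1_left)
    moreover have "k * m > 0" "k * m * m > 0" "k + 3 * (k * m) = 2 * \<mu>"
      using k m by (simp_all add: algebra_simps)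
    ultimately have "balanced_weights \<mu> a (a * m) a \<in> admissible_weights \<mu>"
      unfolding balanced_weights_admissible_iff a by (intro conjI) linarith+
    moreover have "a\<^sup>2 + 3 * a * (a * m) - 2 * \<mu> * (a * m) = 0"
      unfolding k(1)[symmetric] a by (simp add: algebra_simps power2_eq_square)
    moreover have "\<gamma> = balanced_weights \<mu> a (a * m) a"
      by (simp add: \<gamma> f_def a_def power2_eq_square mult.assoc)
    ultimately show "\<gamma> \<in> {balanced_weights \<mu> a b a | a b. balanced_weights \<mu> a b a \<in> admissible_weights \<mu> \<and>
        a\<^sup>2 + 3 * a * b - 2 * \<mu> * b = 0}"
      by blast
  qed
  moreover have "smooth_embedding_on {0<..<1} f"
    by (rule balanced_weights_smooth_embedding[where q = "[:1, 3:]" and A = "[:0, 2 * \<mu>:]"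
          and B = "[:0, 0, 2 * \<mu>:]" and C = "[:0, 2 * \<mu>:]" and k = "\<lambda>\<gamma>. \<gamma> $ 2" and l = "\<lambda>\<gamma>. \<gamma> $ 1"])
      (use assms in \<open>auto simp: f_def balanced_weights_def bounded_linear_vec_nth power2_eq_square
        algebra_simps\<close>)
  ultimately show ?thesis
    using isomorphic_to_intervalI[of 0 1 f] by simp
qed

text \<open>With \<open>m = a / (a + c)\<close> the harmonic relation gives
  \<open>b = m * (1 - m) * (a + c)\<close>, and the sum condition then determines
  \<open>a + c\<close>. The functional \<open>l\<close> is therefore
  \<open>\<gamma> $ 1 + \<gamma> $ 3\<close>.\<close>

lemma curve2b_isomorphic_to_interval:
  assumes "\<mu> > 0"
  shows "isomorphic_to_interval (curve2b \<mu>)"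
proof -
  define f where "f m = balanced_weights \<mu> (\<mu> * m / (1 + m - m\<^sup>2))
    (\<mu> * m * (1 - m) / (1 + m - m\<^sup>2)) (\<mu> * (1 - m) / (1 + m - m\<^sup>2))" for m
  have q: "1 + m - m\<^sup>2 > 0" if "m \<in> {0<..<1}" for m :: real
  proof -
    have "m * m < m * 1"
      using that by (intro mult_strict_left_mono) simp_all
    then show ?thesis
      using that unfolding power2_eq_square greaterThanLessThan_iff by linarith
  qed
  have "curve2b \<mu> = f ` {0<..<1}"
    unfolding curve2b_eq[OF assms]
  proof (intro equalityI subsetI; (elim CollectE exE conjE imageE)?)
    fix \<gamma> a b c
    assume \<gamma>: "\<gamma> = balanced_weights \<mu> a b c" and "balanced_weights \<mu> a b c \<in> admissible_weights \<mu>"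
      and eq: "a * c = b * (a + c)" and sum: "a + b + c = \<mu>"
    then have pos: "a > 0" "b > 0" "c > 0"
      by (simp_all add: balanced_weights_admissible_iff)
    define m where "m = a / (a + c)"
    have m: "m \<in> {0<..<1}" and a: "a = m * (a + c)" and c: "c = (1 - m) * (a + c)"
      using pos by (simp_all add: m_def field_simps)
    have "b = a * c / (a + c)"
      using pos eq by (simp add: nonzero_eq_divide_eq)
    also have "\<dots> = m * c"
      by (simp add: m_def)
    also have "\<dots> = m * (1 - m) * (a + c)"
      by (metis c mult.assoc)
    finally have b: "b = m * (1 - m) * (a + c)" .
    have "(a + c) * (1 + m - m\<^sup>2) = \<mu>"
      using sum b by (simp add: algebra_simps power2_eq_square)
    then have "\<mu> / (1 + m - m\<^sup>2) = a + c"
      using q[OF m] by (simp add: divide_eq_eq)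
    moreover have "f m = balanced_weights \<mu> (m * (\<mu> / (1 + m - m\<^sup>2)))
        (m * (1 - m) * (\<mu> / (1 + m - m\<^sup>2))) ((1 - m) * (\<mu> / (1 + m - m\<^sup>2)))"
      by (simp add: f_def mult_ac)
    ultimately have "f m = \<gamma>"
      unfolding \<gamma> using a b c by metis
    then show "\<gamma> \<in> f ` {0<..<1}"
      using m by blast
  next
    fix \<gamma> m assume \<gamma>: "\<gamma> = f m" and m: "m \<in> {0<..<1::real}"
    define k where "k = \<mu> / (1 + m - m\<^sup>2)"
    have k: "k * (1 + m - m\<^sup>2) = \<mu>" "k > 0"
      using q[OF m] assms by (simp_all add: k_def)
    have "k * m > 0" "k * (1 - m) > 0" "k * (m * (1 - m)) > 0"
      using k m by simp_all
    moreover have eqs: "k * m * (k * (1 - m)) = k * (m * (1 - m)) * (k * m + k * (1 - m))"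
      "k * m + k * (m * (1 - m)) + k * (1 - m) = \<mu>"
      by (simp_all add: k(1)[symmetric] algebra_simps power2_eq_square)
    ultimately have "balanced_weights \<mu> (k * m) (k * (m * (1 - m))) (k * (1 - m)) \<in> admissible_weights \<mu>"
      unfolding balanced_weights_admissible_iff by (intro conjI) linarith+
    moreover have "\<gamma> = balanced_weights \<mu> (k * m) (k * (m * (1 - m))) (k * (1 - m))"
      by (simp add: \<gamma> f_def k_def mult_ac)
    ultimately show "\<gamma> \<in> {balanced_weights \<mu> a b c | a b c. balanced_weights \<mu> a b c \<in> admissible_weights \<mu> \<and>
        a * c = b * (a + c) \<and> a + b + c = \<mu>}"
      using eqs by blast
  qed
  moreover have "smooth_embedding_on {0<..<1} f"
  proof (rule balanced_weights_smooth_embedding[where q = "[:1, 1, -1:]" and A = "[:0, \<mu>:]"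
        and B = "[:0, \<mu>, - \<mu>:]" and C = "[:\<mu>, - \<mu>:]" and k = "\<lambda>\<gamma>. \<gamma> $ 1" and l = "\<lambda>\<gamma>. \<gamma> $ 1 + \<gamma> $ 3"])
    fix m :: real assume m: "m \<in> {0<..<1}"
    have l: "f m $ 1 + f m $ 3 = \<mu> / (1 + m - m\<^sup>2)"
      by (simp add: f_def balanced_weights_def add_divide_distrib[symmetric] algebra_simps)
    show "f m $ 1 = m * (f m $ 1 + f m $ 3)"
      unfolding l by (simp add: f_def balanced_weights_def)
    show "f m $ 1 + f m $ 3 \<noteq> 0"
      unfolding l using q[OF m] assms by simp
    show "poly [:1, 1, - 1:] m \<noteq> 0"
      using q[OF m] by (simp add: algebra_simps power2_eq_square)
  qed (auto simp: f_def bounded_linear_vec_nth bounded_linear_add power2_eq_square algebra_simps)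
  ultimately show ?thesis
    using isomorphic_to_intervalI[of 0 1 f] by simp
qed

text \<open>On \<open>a = c\<close> the harmonic relation becomes \<open>a = 2 * b\<close>, and the
  sum condition gives \<open>5 * b = \<mu>\<close>.\<close>

lemma curve2a_inter_curve2b:
  assumes "\<mu> > 0"
  shows "curve2a \<mu> \<inter> curve2b \<mu> = {balanced_weights \<mu> (2 * \<mu> / 5) (\<mu> / 5) (2 * \<mu> / 5)}"
proof (intro equalityI subsetI)
  fix \<gamma> assume "\<gamma> \<in> curve2a \<mu> \<inter> curve2b \<mu>"
  then obtain a b where "\<gamma> = balanced_weights \<mu> a b a" "a > 0" "a * a = b * (a + a)" "a + b + a = \<mu>"
    unfolding curve2a_eq[OF assms] curve2b_eq[OF assms]
    by (auto simp: balanced_weights_eq_iff balanced_weights_admissible_iff)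
  moreover from this have "a = 2 * b"
    by (simp add: algebra_simps)
  ultimately show "\<gamma> \<in> {balanced_weights \<mu> (2 * \<mu> / 5) (\<mu> / 5) (2 * \<mu> / 5)}"
    by (simp add: balanced_weights_eq_iff)
next
  fix \<gamma> assume \<gamma>: "\<gamma> \<in> {balanced_weights \<mu> (2 * \<mu> / 5) (\<mu> / 5) (2 * \<mu> / 5)}"
  have "balanced_weights \<mu> (2 * \<mu> / 5) (\<mu> / 5) (2 * \<mu> / 5) \<in> admissible_weights \<mu>"
    using assms by (simp add: balanced_weights_admissible_iff)
  moreover have "(2 * \<mu> / 5)\<^sup>2 + 3 * (2 * \<mu> / 5) * (\<mu> / 5) - 2 * \<mu> * (\<mu> / 5) = 0"
    "(2 * \<mu> / 5) * (2 * \<mu> / 5) = \<mu> / 5 * (2 * \<mu> / 5 + 2 * \<mu> / 5)"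
    "2 * \<mu> / 5 + \<mu> / 5 + 2 * \<mu> / 5 = \<mu>"
    by (simp_all add: field_simps power2_eq_square)
  ultimately show "\<gamma> \<in> curve2a \<mu> \<inter> curve2b \<mu>"
    unfolding curve2a_eq[OF assms] curve2b_eq[OF assms] using \<gamma> by blast
qed

section \<open>Matching the curves with sign patterns\<close>

lemma balanced_weights_in_sign_set_iff:
  "balanced_weights \<mu> a b c \<in> sign_set \<mu> s t u \<longleftrightarrow>
    balanced_weights \<mu> a b c \<in> admissible_weights \<mu> \<and>
    s * (\<mu> - b - c) - b * c / a = t * (\<mu> - a - b) - a * b / c \<and>
    t * (\<mu> - a - b) - a * b / c = u * (\<mu> - a - c) - a * c / b"
  by (auto simp: sign_set_def balanced_weights_def)

lemma sign_set_eq_balanced: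
  "sign_set \<mu> s t u = {balanced_weights \<mu> a b c | a b c. balanced_weights \<mu> a b c \<in> sign_set \<mu> s t u}"
proof (intro equalityI subsetI)
  fix \<gamma> assume \<gamma>: "\<gamma> \<in> sign_set \<mu> s t u"
  then have "\<gamma> = balanced_weights \<mu> (\<gamma> $ 1) (\<gamma> $ 2) (\<gamma> $ 3)"
    using admissible_weights_balanced by (simp add: sign_set_def)
  then show "\<gamma> \<in> {balanced_weights \<mu> a b c | a b c. balanced_weights \<mu> a b c \<in> sign_set \<mu> s t u}"
    using \<gamma> by (metis (mono_tags, lifting) mem_Collect_eq)
qed auto

lemma sign_set_eqI:
  assumes "\<And>a b c. balanced_weights \<mu> a b c \<in> admissible_weights \<mu> \<Longrightarrow>
    balanced_weights \<mu> a b c \<in> sign_set \<mu> s t u \<longleftrightarrow> P a b c"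
  shows "sign_set \<mu> s t u =
    {balanced_weights \<mu> a b c | a b c. balanced_weights \<mu> a b c \<in> admissible_weights \<mu> \<and> P a b c}"
proof -
  have "balanced_weights \<mu> a b c \<in> sign_set \<mu> s t u \<longleftrightarrow>
      balanced_weights \<mu> a b c \<in> admissible_weights \<mu> \<and> P a b c" for a b c
    using assms balanced_weights_in_sign_set_iff by blast
  then show ?thesis
    by (subst sign_set_eq_balanced) simp
qed

text \<open>The two equal positive signs give \<open>a = c\<close>; the remaining equation,
  multiplied by \<open>b\<close>, is the conic.\<close>

lemma curve1_eq_sign_set:
  assumes "\<mu> > 0"
  shows "curve1 \<mu> = sign_set \<mu> 1 1 (-1)"
proof -
  have "balanced_weights \<mu> a b c \<in> sign_set \<mu> 1 1 (-1) \<longleftrightarrow>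
      a = c \<and> a\<^sup>2 - 3 * a * b + 2 * \<mu> * b - 2 * b\<^sup>2 = 0"
    if "balanced_weights \<mu> a b c \<in> admissible_weights \<mu>" for a b c
  proof -
    have pos: "a > 0" "b > 0" "c > 0"
      using that by (simp_all add: balanced_weights_admissible_iff)
    have 1: "(\<mu> - b - c) - b * c / a = (\<mu> - a - b) - a * b / c \<longleftrightarrow> a = c"
      using pos by (intro same_sign_plus_iff) simp_all
    have 2: "(\<mu> - a - b) - a * b / a = - (\<mu> - a - a) - a * a / b \<longleftrightarrow>
        a\<^sup>2 - 3 * a * b + 2 * \<mu> * b - 2 * b\<^sup>2 = 0"
    proof -
      have "(\<mu> - a - b) - b - (- (\<mu> - a - a) - a * a / b) =
          (a\<^sup>2 - 3 * a * b + 2 * \<mu> * b - 2 * b\<^sup>2) / b"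
        using pos by (simp add: field_simps power2_eq_square)
      then show ?thesis
        using pos by (subst eq_iff_diff_eq_0) simp
    qed
    show ?thesis
      unfolding balanced_weights_in_sign_set_iff using that 1 2 by auto
  qed
  then show ?thesis
    unfolding curve1_eq[OF assms] by (subst sign_set_eqI) blast+
qed

text \<open>The two equal negative signs leave the alternatives \<open>a = c\<close> and the
  harmonic relation, which yield the two curves.\<close>

lemma curve2_eq_sign_set:
  assumes "\<mu> > 0"
  shows "curve2a \<mu> \<union> curve2b \<mu> = sign_set \<mu> (-1) (-1) 1"
proof -
  have "balanced_weights \<mu> a b c \<in> sign_set \<mu> (-1) (-1) 1 \<longleftrightarrow>
      a = c \<and> a\<^sup>2 + 3 * a * b - 2 * \<mu> * b = 0 \<or> a * c = b * (a + c) \<and> a + b + c = \<mu>"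
    if adm: "balanced_weights \<mu> a b c \<in> admissible_weights \<mu>" for a b c
  proof -
    have pos: "a > 0" "b > 0" "c > 0"
      using adm by (simp_all add: balanced_weights_admissible_iff)
    have 1: "- (\<mu> - b - c) - b * c / a = - (\<mu> - a - b) - a * b / c \<longleftrightarrow>
        a = c \<or> a * c = b * (a + c)"
      using pos by (intro same_sign_minus_iff) simp_all
    have 2: "- (\<mu> - a - b) - a * b / c = (\<mu> - a - c) - a * c / b \<longleftrightarrow> a\<^sup>2 + 3 * a * b - 2 * \<mu> * b = 0"
      if "a = c"
      using that pos by (auto simp: field_simps power2_eq_square)
    have 3: "- (\<mu> - a - b) - a * b / c = (\<mu> - a - c) - a * c / b \<longleftrightarrow> a + b + c = \<mu>"
      if "a * c = b * (a + c)"
    proof -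
      \<comment> \<open>The harmonic relation removes both quotients, so the second equation becomes
        linear.\<close>
      have "a * b / c = a - b" "a * c / b = a + c"
        using that pos by (simp_all add: field_simps)
      then show ?thesis by auto
    qed
    show ?thesis
      unfolding balanced_weights_in_sign_set_iff mult_minus1 mult_1 1 using adm 2 3 by blast
  qed
  then show ?thesis
    unfolding curve2a_eq[OF assms] curve2b_eq[OF assms] by (subst sign_set_eqI) blast+
qed

section \<open>The connected components\<close>

lemma rotation_orbit_rotate:
  "rotation_orbit (rotate_weights ` C) = rotation_orbit C"
proof -
  have "rotate_weights ` rotate_weights ` rotate_weights ` C = C"
    by (simp add: image_image rotate_weights_cubed)
  then show ?thesis
    unfolding rotation_orbit_def image_comp[symmetric] by auto
qed

text \<open>Rotations carry connectedness and nonemptiness from the two explicit sets to all six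
  sign sets; the union of \<open>curve2a\<close> and \<open>curve2b\<close> is connected through
  their common point. Disjointness of nonempty sets gives the count of six.\<close>

lemma components_one_flat_band_weights:
  assumes \<mu>: "\<mu> > 0"
  defines "F \<equiv> rotation_orbit (curve1 \<mu>) \<union> rotation_orbit (curve2a \<mu> \<union> curve2b \<mu>)"
  shows "components (one_flat_band_weights \<mu>) = F" "card F = 6"
    "rotation_orbit (curve1 \<mu>) \<noteq> rotation_orbit (curve2a \<mu> \<union> curve2b \<mu>)"
proof -
  let ?K = "sign_set \<mu>"
  define L where "L = [?K 1 1 (-1), ?K (-1) 1 1, ?K 1 (-1) 1, ?K (-1) (-1) 1, ?K 1 (-1) (-1), ?K (-1) 1 (-1)]"
  have orbits: "rotation_orbit (curve1 \<mu>) = {?K 1 1 (-1), ?K (-1) 1 1, ?K 1 (-1) 1}"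
    "rotation_orbit (curve2a \<mu> \<union> curve2b \<mu>) = {?K (-1) (-1) 1, ?K 1 (-1) (-1), ?K (-1) 1 (-1)}"
    unfolding rotation_orbit_def image_comp[symmetric] curve1_eq_sign_set[OF \<mu>]
      curve2_eq_sign_set[OF \<mu>] rotate_weights_sign_set by simp_all
  have F: "F = set L"
    unfolding F_def orbits L_def by auto
  have conn1: "connected (curve1 \<mu>)" "curve1 \<mu> \<noteq> {}"
    using isomorphic_to_interval_imp_connected[OF curve1_isomorphic_to_interval[OF \<mu>]] \<mu>
    by (auto simp: curve1_def)
  have conn2: "connected (curve2a \<mu> \<union> curve2b \<mu>)" "curve2a \<mu> \<union> curve2b \<mu> \<noteq> {}"
    using isomorphic_to_interval_imp_connected[OF curve2a_isomorphic_to_interval[OF \<mu>]]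
      isomorphic_to_interval_imp_connected[OF curve2b_isomorphic_to_interval[OF \<mu>]]
      curve2a_inter_curve2b[OF \<mu>]
    by (auto intro: connected_Un)
  have conn: "connected C \<and> C \<noteq> {}" if "C \<in> F" for C
    using that conn1 conn2 unfolding F_def rotation_orbit_def image_comp[symmetric]
    by (auto simp del: image_Un intro: connected_rotate_weights)
  have disj: "pairwise disjnt F"
    unfolding F L_def pairwise_def by (auto intro!: sign_sets_disjoint)
  have inF: "?K s t u \<in> F"
    if "s \<in> {1, -1}" "t \<in> {1, -1}" "u \<in> {1, -1}" "\<not> (s = t \<and> t = u)" for s t u
    using that unfolding F L_def by auto
  have ne: "?K s t u \<noteq> ?K s' t' u'"
    if "s \<in> {1, -1}" "t \<in> {1, -1}" "u \<in> {1, -1}" "s' \<in> {1, -1}" "t' \<in> {1, -1}" "u' \<in> {1, -1}"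
      "\<not> (s = t \<and> t = u)" "\<not> (s' = t' \<and> t' = u')" "(s, t, u) \<noteq> (s', t', u')" for s t u s' t' u'
  proof -
    have "?K s t u \<noteq> {}"
      using conn[OF inF[OF that(1-3,7)]] by blast
    then show ?thesis
      using sign_sets_disjoint[OF that, of \<mu>] by (auto simp: disjnt_def)
  qed
  have "distinct L"
    unfolding L_def by (simp add: ne)
  show "components (one_flat_band_weights \<mu>) = F"
  proof (rule components_eqI[OF _ _ disj conn])
    show "\<Union>F = one_flat_band_weights \<mu>"
      unfolding F L_def one_flat_band_weights_eq[OF \<mu>] by auto
    then show "closedin (top_of_set (one_flat_band_weights \<mu>)) C" if "C \<in> F" for C
      using that unfolding F L_def
      by (auto intro!: closedin_sign_set simp: one_flat_band_weights_def)
  qed (simp_all add: F)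
  show "card F = 6"
    using \<open>distinct L\<close> unfolding F by (simp add: distinct_card) (simp add: L_def)
  have "?K 1 1 (-1) \<notin> {?K (-1) (-1) 1, ?K 1 (-1) (-1), ?K (-1) 1 (-1)}"
    by (simp add: ne)
  then show "rotation_orbit (curve1 \<mu>) \<noteq> rotation_orbit (curve2a \<mu> \<union> curve2b \<mu>)"
    unfolding orbits by (metis insertI1)
qed

text \<open>Equal weights have two flat eigenvalues, while a mixed sign pattern allows only
  one.\<close>

lemma two_flat_band_weights_disjoint:
  assumes "\<mu> > 0"
  shows "one_flat_band_weights \<mu> \<inter> two_flat_band_weights \<mu> = {}"
proof (rule ccontr)
  assume "\<not> ?thesis"
  then obtain \<gamma> where one: "\<gamma> \<in> one_flat_band_weights \<mu>" and two: "\<gamma> \<in> two_flat_band_weights \<mu>"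
    by blast
  from two have eq: "\<gamma> $ 1 = \<gamma> $ 2" "\<gamma> $ 2 = \<gamma> $ 3"
    by (auto simp: two_flat_band_weights_def)
  obtain s t u where stu: "s \<in> {1, -1}" "t \<in> {1, -1}" "u \<in> {1, -1}" "\<not> (s = t \<and> t = u)"
    and \<gamma>: "\<gamma> \<in> sign_set \<mu> s t u"
    using one unfolding one_flat_band_weights_iff[OF assms] by blast
  then have adm: "\<gamma> \<in> admissible_weights \<mu>"
    by (simp add: sign_set_def)
  have "\<gamma> $ 7 - \<gamma> $ 1 = - \<gamma> $ 7 - \<gamma> $ 1"
    using two_flat_eigenvalues_if_equal[OF adm eq]
      mixed_sign_flat_eigenvalue_unique[OF \<gamma> stu] by metis
  then show False
    using admissible_weights_pos[OF adm, of 7] by simp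
qed

theorem theorem12:
  fixes \<mu> :: real
  assumes "\<mu> > 0"
  shows "let S = one_flat_band_weights \<mu>;
             C1 = curve1 \<mu>;
             C2 = curve2a \<mu> \<union> curve2b \<mu>
         in card (components S) = 6 \<and>
            pairwise disjnt (components S) \<and>
            (\<forall>C\<in>components S. C \<inter> two_flat_band_weights \<mu> = {}) \<and>
            rotate_weights ` S = S \<and>
            (rotate_weights \<circ> rotate_weights) ` S = S \<and>
            C1 \<in> components S \<and> C2 \<in> components S \<and>
            rotation_orbit C1 \<noteq> rotation_orbit C2 \<and>
            rotation_orbit ` components S = {rotation_orbit C1, rotation_orbit C2} \<and>
            one_dim_submanifold C1 \<and> isomorphic_to_interval C1 \<and>
            one_dim_submanifold (curve2a \<mu>) \<and> isomorphic_to_interval (curve2a \<mu>) \<and>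
            one_dim_submanifold (curve2b \<mu>) \<and> isomorphic_to_interval (curve2b \<mu>) \<and>
            (\<exists>\<gamma>. curve2a \<mu> \<inter> curve2b \<mu> = {\<gamma>})"
proof -
  let ?S = "one_flat_band_weights \<mu>" and ?C1 = "curve1 \<mu>" and ?C2 = "curve2a \<mu> \<union> curve2b \<mu>"
  note comps = components_one_flat_band_weights[OF assms]
  have rot: "rotate_weights ` ?S = ?S"
    unfolding one_flat_band_weights_eq[OF assms] image_Un rotate_weights_sign_set by blast
  have disj: "C \<inter> two_flat_band_weights \<mu> = {}" if "C \<in> components ?S" for C
    using two_flat_band_weights_disjoint[OF assms] in_components_subset[OF that] by blast
  have orbit: "C \<in> rotation_orbit C" "rotation_orbit ` rotation_orbit C = {rotation_orbit C}" for C
  proof -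
    show "C \<in> rotation_orbit C"
      by (simp add: rotation_orbit_def)
    show "rotation_orbit ` rotation_orbit C = {rotation_orbit C}"
    proof -
      have "rotation_orbit C = {C, rotate_weights ` C, rotate_weights ` rotate_weights ` C}"
        by (simp only: rotation_orbit_def image_comp[symmetric])
      moreover have "rotation_orbit ` {C, rotate_weights ` C, rotate_weights ` rotate_weights ` C} =
          {rotation_orbit C}"
        by (simp add: rotation_orbit_rotate)
      ultimately show ?thesis by metis
    qed
  qed
  \<comment> \<open>The components form two orbits, and \<open>rotation_orbit\<close> is constant on
    each.\<close>
  have orbits: "rotation_orbit ` components ?S = {rotation_orbit ?C1, rotation_orbit ?C2}"
    unfolding comps(1) image_Un orbit by blast
  have card: "card (components ?S) = 6"
    using comps by simp
  have mem: "?C1 \<in> components ?S" "?C2 \<in> components ?S"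
    unfolding comps(1) using orbit(1) by blast+
  have disjnt: "pairwise disjnt (components ?S)"
    unfolding disjnt_def[abs_def] by (rule pairwise_disjoint_components)
  have rot2: "(rotate_weights \<circ> rotate_weights) ` ?S = ?S"
    by (simp only: image_comp[symmetric] rot)
  note curves = curve1_isomorphic_to_interval[OF assms] curve2a_isomorphic_to_interval[OF assms]
    curve2b_isomorphic_to_interval[OF assms]
  note submanifolds = curves[THEN isomorphic_to_interval_imp_one_dim_submanifold]
  have inter: "\<exists>\<gamma>. curve2a \<mu> \<inter> curve2b \<mu> = {\<gamma>}"
    using curve2a_inter_curve2b[OF assms] by blast
  show ?thesis
    unfolding Let_def
    by (intro conjI ballI card disjnt disj rot rot2 mem comps(3) orbits curves submanifolds
        inter)
qed

end
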